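(* Let $N\ge 2$, $p\in[2,\infty[$ with $p>N$, $r_0>0$, $\lambda\in[0,C_H]$ where $C_H=\left|\frac{p-N}{p}\right|^p$, and consider the equation $$-\Delta_p u-\frac{\lambda}{|x|^p}|u|^{p-2}u=0\quad\text{in }B]r_0,\infty[.$$ Let $\alpha_\lambda\le\bar\alpha_\lambda$ be the roots in $\left[0,\frac{p-N}{p-1}\right]$ of $\alpha|\alpha|^{p-2}\big(p-N-(p-1)\alpha\big)=\lambda$. Then: (a) for every positive radial strictly monotone increasing $C^2$ strict supersolution $v$ of the equation there is $C>0$ with $|x|^{\alpha_\lambda}\le C\,v(x)$ for all $x\in B[r_0,\infty[$; (b) for every positive (not necessarily radial or increasing) $C^2$-supersolution $w$ of the equation: if $\lambda<C_H$ then $\displaystyle\limsup_{|x|\to\infty}\frac{|x|^{\bar\alpha_\lambda}}{w(x)}>0$, while if $\lambda=C_H$ then for every $\tau>0$ $$\limsup_{|x|\to\infty}\frac{|x|^{\frac{p-N}{p}}(\log|x|)^{2/p}(\log\log|x|)^\tau}{w(x)}>0.$$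
   Context: $\Delta_p u=\nabla\cdot(|\nabla u|^{p-2}\nabla u)$. $B]r_0,\infty[=\{x\in\mathbb{R}^N:|x|>r_0\}$, $B[r_0,\infty[=\{x:|x|\ge r_0\}$. A $C^2$-supersolution is a function $w\in C^2(B[r_0,\infty[)$ with $-\Delta_p w-\lambda|x|^{-p}|w|^{p-2}w\ge 0$ pointwise in $B]r_0,\infty[$; a strict supersolution has $>0$ at every point. A radial function $v(x)=\phi(|x|)$ is strictly monotone increasing if $\phi'(r)>0$ for all $r\ge r_0$. (For $0<\lambda<C_H$ there are exactly two such roots, for $\lambda=C_H$ they coincide and equal $\frac{p-N}{p}$, and for $\lambda=0$ they are $0$ and $\frac{p-N}{p-1}$.) *)

theory Defs
  imports "HOL-Analysis.Analysis"
begin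

definition grad :: "('a::euclidean_space \<Rightarrow> real) \<Rightarrow> 'a \<Rightarrow> 'a" where
  "grad w x = (\<Sum>b\<in>Basis. frechet_derivative w (at x) b *\<^sub>R b)"

definition C2_on_open :: "'a::euclidean_space set \<Rightarrow> ('a \<Rightarrow> real) \<Rightarrow> bool" where
  "C2_on_open U w \<longleftrightarrow> open U \<and>
     (\<forall>x\<in>U. w differentiable (at x)) \<and>
     (\<forall>x\<in>U. grad w differentiable (at x)) \<and>
     (\<forall>b\<in>Basis. continuous_on U (\<lambda>x. frechet_derivative (grad w) (at x) b))"

definition C2_on :: "'a::euclidean_space set \<Rightarrow> ('a \<Rightarrow> real) \<Rightarrow> bool" where
  "C2_on S w \<longleftrightarrow> (\<exists>U. S \<subseteq> U \<and> C2_on_open U w)"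

definition p_laplacian :: "real \<Rightarrow> ('a::euclidean_space \<Rightarrow> real) \<Rightarrow> 'a \<Rightarrow> real" where
  "p_laplacian p w x =
     (\<Sum>b\<in>Basis. frechet_derivative (\<lambda>y. norm (grad w y) powr (p - 2) *\<^sub>R grad w y) (at x) b \<bullet> b)"

definition hardy_op :: "real \<Rightarrow> real \<Rightarrow> ('a::euclidean_space \<Rightarrow> real) \<Rightarrow> 'a \<Rightarrow> real" where
  "hardy_op p lam w x = - p_laplacian p w x - lam * norm x powr (- p) * (\<bar>w x\<bar> powr (p - 2) * w x)"

definition supersolution :: "real \<Rightarrow> real \<Rightarrow> real \<Rightarrow> ('a::euclidean_space \<Rightarrow> real) \<Rightarrow> bool" where
  "supersolution p lam r0 w \<longleftrightarrow> C2_on {x. norm x \<ge> r0} w \<and>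
     (\<forall>x. norm x > r0 \<longrightarrow> hardy_op p lam w x \<ge> 0)"

definition strict_supersolution :: "real \<Rightarrow> real \<Rightarrow> real \<Rightarrow> ('a::euclidean_space \<Rightarrow> real) \<Rightarrow> bool" where
  "strict_supersolution p lam r0 w \<longleftrightarrow> C2_on {x. norm x \<ge> r0} w \<and>
     (\<forall>x. norm x > r0 \<longrightarrow> hardy_op p lam w x > 0)"

definition radial_strict_incr :: "real \<Rightarrow> ('a::real_normed_vector \<Rightarrow> real) \<Rightarrow> bool" where
  "radial_strict_incr r0 v \<longleftrightarrow> (\<exists>\<phi>::real \<Rightarrow> real.
     (\<forall>x. norm x \<ge> r0 \<longrightarrow> v x = \<phi> (norm x)) \<and>
     (\<forall>r\<ge>r0. \<exists>d>0. (\<phi> has_real_derivative d) (at r within {r0..})))"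

text \<open>The function whose level sets define the exponents alpha_lambda.\<close>
definition expo_fun :: "real \<Rightarrow> real \<Rightarrow> real \<Rightarrow> real" where
  "expo_fun p N \<alpha> = \<alpha> * \<bar>\<alpha>\<bar> powr (p - 2) * (p - N - (p - 1) * \<alpha>)"

definition C_H :: "real \<Rightarrow> real \<Rightarrow> real" where
  "C_H p N = \<bar>(p - N) / p\<bar> powr p"

end

theory Submission
  imports Defs "HOL-Real_Asymp.Real_Asymp"
begin

text \<open>
In the variable $t = \ln r$ a radial function $\phi$ with logarithmic derivative $y = r\phi'/\phi > 0$ is a
supersolution iff $(p-1)\,y^{p-2}\,\dot y \le E(y) - \lambda$, where $E$ is \<open>expo_fun\<close>. Below the
smallest root of $E = \lambda$ the right-hand side is negative and bounded away from $0$ along the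
solution, so $y^{p-1}$ would become negative in finite time; hence $y \ge \alpha_\lambda$, which gives (a).

For (b), suppose that $w$ dominates every multiple of the comparison function, and let $u = r^a f(\ln r)$
be a radial strict subsolution with $u = 0$ on a sphere and $u$ bounded by the comparison function. Then
$u/w$ attains its maximum at an interior point, where a multiple of $u$ touches $w$ from below and the
two differential inequalities contradict each other. Suitable profiles are $f = 1 - e^{-\epsilon(t-t_1)}$
with $a = \bar\alpha_\lambda$ if $\lambda < C_H$, and $f = g - g(t_1)$ with $g = t^{2/p}(\ln t)^\tau$,
$a = (p-N)/p$ and $t_1$ large if $\lambda = C_H$.
\<close>

section \<open>The $p$-Laplacian at non-critical points\<close>

lemma has_derivative_grad:
  assumes "w differentiable (at x)"
  shows "(w has_derivative (\<lambda>h. grad w x \<bullet> h)) (at x)"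
proof -
  have D: "(w has_derivative frechet_derivative w (at x)) (at x)"
    using assms frechet_derivative_works by blast
  interpret bounded_linear "frechet_derivative w (at x)"
    using D by (rule has_derivative_bounded_linear)
  have "frechet_derivative w (at x) h = grad w x \<bullet> h" for h
  proof -
    have "frechet_derivative w (at x) h = frechet_derivative w (at x) (\<Sum>b\<in>Basis. (h \<bullet> b) *\<^sub>R b)"
      by (simp add: euclidean_representation)
    also have "\<dots> = (\<Sum>b\<in>Basis. (h \<bullet> b) * frechet_derivative w (at x) b)"
      by (simp add: sum scaleR)
    also have "\<dots> = grad w x \<bullet> h"
      by (simp add: grad_def inner_sum_left inner_commute[of h] mult.commute)
    finally show ?thesis .
  qed
  then have "frechet_derivative w (at x) = (\<lambda>h. grad w x \<bullet> h)" by blast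
  then show ?thesis using D by metis
qed

lemma grad_eqI:
  assumes "(w has_derivative (\<lambda>h. g \<bullet> h)) (at x)"
  shows "grad w x = g"
  using frechet_derivative_at[OF assms, symmetric]
  by (simp add: grad_def euclidean_representation)

text \<open>The nondivergence form, by the product and chain rules. The Hessian \<open>M\<close>
  enters linearly, through its trace and its quadratic form in the gradient direction; for p >= 2
  both weights are nonnegative, which later allows Hessians to be compared. The gradient must not
  vanish because \<open>norm\<close> and \<open>powr\<close> are differentiated at it.\<close>

lemma p_laplacian_eq:
  assumes M: "(grad w has_derivative M) (at x)" and nz: "grad w x \<noteq> 0"
  shows "p_laplacian p w x = norm (grad w x) powr (p - 2) *
     ((\<Sum>b\<in>Basis. M b \<bullet> b) + (p - 2) * (M (grad w x) \<bullet> grad w x) / (norm (grad w x))\<^sup>2)"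
proof -
  define \<xi> where "\<xi> = grad w x"
  have nz: "norm \<xi> > 0" using nz by (simp add: \<xi>_def)
  interpret M: bounded_linear M using M by (rule has_derivative_bounded_linear)
  have n: "((\<lambda>y. norm (grad w y)) has_derivative (\<lambda>h. M h \<bullet> sgn \<xi>)) (at x)"
    using has_derivative_compose[OF M has_derivative_norm] nz by (simp add: \<xi>_def)
  have pw: "((\<lambda>t. t powr (p - 2)) has_derivative (*) ((p - 2) * norm \<xi> powr (p - 2 - 1))) (at (norm \<xi>))"
    using has_real_derivative_powr[OF nz, of "p-2"] by (simp add: has_field_derivative_def)
  have "((\<lambda>y. norm (grad w y) powr (p - 2)) has_derivative
        (\<lambda>h. (p - 2) * norm \<xi> powr (p - 2 - 1) * (M h \<bullet> sgn \<xi>))) (at x)"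
    using has_derivative_compose[OF n, of "\<lambda>t. t powr (p - 2)"] pw by (simp add: \<xi>_def)
  from has_derivative_scaleR[OF this M]
  have "((\<lambda>y. norm (grad w y) powr (p - 2) *\<^sub>R grad w y) has_derivative
      (\<lambda>h. norm \<xi> powr (p - 2) *\<^sub>R M h + ((p - 2) * norm \<xi> powr (p - 2 - 1) * (M h \<bullet> sgn \<xi>)) *\<^sub>R \<xi>)) (at x)"
    by (simp add: \<xi>_def)
  from frechet_derivative_at[OF this, symmetric]
  have "p_laplacian p w x = (\<Sum>b\<in>Basis. (norm \<xi> powr (p - 2) *\<^sub>R M b
       + ((p - 2) * norm \<xi> powr (p - 2 - 1) * (M b \<bullet> sgn \<xi>)) *\<^sub>R \<xi>) \<bullet> b)"
    by (simp add: p_laplacian_def)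
  also have "\<dots> = norm \<xi> powr (p - 2) * (\<Sum>b\<in>Basis. M b \<bullet> b)
      + (p - 2) * norm \<xi> powr (p - 2 - 1) * (\<Sum>b\<in>Basis. (M b \<bullet> sgn \<xi>) * (\<xi> \<bullet> b))"
    by (simp add: inner_add_left sum.distrib sum_distrib_left mult.assoc)
  also have "(\<Sum>b\<in>Basis. (M b \<bullet> sgn \<xi>) * (\<xi> \<bullet> b)) = M (\<Sum>b\<in>Basis. (\<xi> \<bullet> b) *\<^sub>R b) \<bullet> sgn \<xi>"
    by (simp add: M.sum M.scaleR inner_sum_left mult.commute)
  also have "\<dots> = M \<xi> \<bullet> \<xi> / norm \<xi>"
    by (simp add: euclidean_representation sgn_div_norm divide_inverse mult.commute)
  also have "norm \<xi> powr (p - 2 - 1) = norm \<xi> powr (p - 2) / norm \<xi>"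
    using nz by (simp only: powr_diff) simp
  finally show ?thesis using nz
    by (simp add: \<xi>_def[symmetric] field_simps power2_eq_square)
qed

section \<open>Radial gradient fields\<close>

text \<open>The Jacobian has the eigenvalue q' in the radial direction and q/r on its orthogonal
  complement; it is kept in this split form so that trace and radial quadratic form can be read off.
  Differentiating (q/r) y instead of the given field avoids a derivative of
  \<open>sgn\<close>.\<close>

lemma has_derivative_radial_field:
  fixes x :: "'a::euclidean_space"
  assumes q: "(q has_real_derivative q') (at (norm x))" and x: "x \<noteq> 0"
  shows "((\<lambda>y. q (norm y) *\<^sub>R sgn y) has_derivative
     (\<lambda>e. (q' * (sgn x \<bullet> e)) *\<^sub>R sgn x + (q (norm x) / norm x) *\<^sub>R (e - (sgn x \<bullet> e) *\<^sub>R sgn x))) (at x)"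
proof -
  have r: "norm x > 0" using x by simp
  have "((\<lambda>r. q r / r) has_real_derivative (q' * norm x - q (norm x)) / (norm x * norm x)) (at (norm x))"
    using r by (auto intro!: derivative_eq_intros q)
  then have "((\<lambda>r. q r / r) has_derivative (*) ((q' * norm x - q (norm x)) / (norm x * norm x))) (at (norm x))"
    by (simp add: has_field_derivative_def)
  from has_derivative_compose[OF has_derivative_norm[OF x] this]
  have "((\<lambda>y. q (norm y) / norm y) has_derivative
     (\<lambda>e. (q' * norm x - q (norm x)) / (norm x * norm x) * (e \<bullet> sgn x))) (at x)" .
  from has_derivative_scaleR[OF this has_derivative_ident]
  have *: "((\<lambda>y. (q (norm y) / norm y) *\<^sub>R y) has_derivative (\<lambda>e. (q (norm x) / norm x) *\<^sub>R e +
     ((q' * norm x - q (norm x)) / (norm x * norm x) * (e \<bullet> sgn x)) *\<^sub>R x)) (at x)" .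
  have xs: "x = norm x *\<^sub>R sgn x" using x by (simp add: sgn_div_norm)
  have "(q (norm x) / norm x) *\<^sub>R e + ((q' * norm x - q (norm x)) / (norm x * norm x) * (e \<bullet> sgn x)) *\<^sub>R x
     = (q' * (sgn x \<bullet> e)) *\<^sub>R sgn x + (q (norm x) / norm x) *\<^sub>R (e - (sgn x \<bullet> e) *\<^sub>R sgn x)" for e
  proof -
    have "((q' * norm x - q (norm x)) / (norm x * norm x) * (e \<bullet> sgn x)) *\<^sub>R x =
       ((q' * norm x - q (norm x)) / (norm x * norm x) * (e \<bullet> sgn x) * norm x) *\<^sub>R sgn x"
      using xs by (metis scaleR_scaleR)
    also have "(q' * norm x - q (norm x)) / (norm x * norm x) * (e \<bullet> sgn x) * norm x
       = q' * (sgn x \<bullet> e) - (q (norm x) / norm x) * (sgn x \<bullet> e)"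
      using r by (simp add: field_simps inner_commute)
    finally show ?thesis by (simp add: algebra_simps)
  qed
  moreover have "(\<lambda>y::'a. (q (norm y) / norm y) *\<^sub>R y) = (\<lambda>y. q (norm y) *\<^sub>R sgn y)"
    by (simp add: sgn_div_norm divide_inverse)
  ultimately show ?thesis using * by (simp only:)
qed

lemma sum_Basis_inner_sq: "(\<Sum>b\<in>Basis. (y \<bullet> b) * (y \<bullet> b)) = (norm y)\<^sup>2" for y :: "'a::euclidean_space"
  by (metis euclidean_inner power2_norm_eq_inner)

lemma radial_field_trace:
  fixes x :: "'a::euclidean_space"
  assumes "x \<noteq> 0"
  shows "(\<Sum>b\<in>Basis. ((A * (sgn x \<bullet> b)) *\<^sub>R sgn x + B *\<^sub>R (b - (sgn x \<bullet> b) *\<^sub>R sgn x)) \<bullet> b)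
     = A + (real DIM('a) - 1) * B"
proof -
  have 1: "(\<Sum>b\<in>Basis. (sgn x \<bullet> b) * (sgn x \<bullet> b)) = 1"
    using assms by (simp add: sum_Basis_inner_sq norm_sgn)
  have "(\<Sum>b\<in>Basis. ((A * (sgn x \<bullet> b)) *\<^sub>R sgn x + B *\<^sub>R (b - (sgn x \<bullet> b) *\<^sub>R sgn x)) \<bullet> b)
    = (\<Sum>b\<in>Basis. (A - B) * ((sgn x \<bullet> b) * (sgn x \<bullet> b)) + B * (b \<bullet> b))"
    by (intro sum.cong refl) (simp add: algebra_simps inner_add_left inner_diff_left)
  also have "\<dots> = (A - B) * (\<Sum>b\<in>Basis. (sgn x \<bullet> b) * (sgn x \<bullet> b)) + B * (\<Sum>b\<in>(Basis::'a set). b \<bullet> b)"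
    by (simp only: sum.distrib sum_distrib_left)
  also have "(\<Sum>b\<in>(Basis::'a set). b \<bullet> b) = real DIM('a)" by simp
  finally show ?thesis by (simp add: 1 algebra_simps)
qed

text \<open>The radial formula is assumed for the gradient, and on a neighbourhood, because it is
  differentiated once more. The trace contributes one radial and DIM - 1 tangential eigenvalues, the
  gradient direction only the radial one.\<close>

lemma p_laplacian_radial:
  fixes x :: "'a::euclidean_space"
  assumes g: "\<forall>\<^sub>F y in nhds x. grad w y = q (norm y) *\<^sub>R sgn y"
    and q: "(q has_real_derivative q') (at (norm x))" and pos: "q (norm x) > 0" and x: "x \<noteq> 0"
  shows "p_laplacian p w x = q (norm x) powr (p - 2) *
     ((p - 1) * q' + (real DIM('a) - 1) * q (norm x) / norm x)"
proof -
  let ?M = "\<lambda>e. (q' * (sgn x \<bullet> e)) *\<^sub>R sgn x + (q (norm x) / norm x) *\<^sub>R (e - (sgn x \<bullet> e) *\<^sub>R sgn x)"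
  have gx: "grad w x = q (norm x) *\<^sub>R sgn x" using g by (rule eventually_nhds_x_imp_x)
  have D: "(grad w has_derivative ?M) (at x)"
    using g has_derivative_transform_within_open[OF has_derivative_radial_field[OF q x], of _ "grad w"]
    unfolding eventually_nhds by metis
  have s: "sgn x \<bullet> sgn x = 1" using x by (simp add: norm_sgn flip: power2_norm_eq_inner)
  have ss: "?M (grad w x) \<bullet> grad w x / (norm (grad w x))\<^sup>2 = q'"
    using pos x s by (simp add: gx norm_sgn power2_eq_square)
  have nz: "grad w x \<noteq> 0" using gx pos x by (simp add: sgn_zero_iff)
  have "p_laplacian p w x = norm (grad w x) powr (p - 2) *
     ((\<Sum>b\<in>Basis. ?M b \<bullet> b) + (p - 2) * (?M (grad w x) \<bullet> grad w x / (norm (grad w x))\<^sup>2))"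
    using p_laplacian_eq[OF D nz] by (simp only: times_divide_eq_right)
  then have "p_laplacian p w x = norm (grad w x) powr (p - 2) *
     (q' + (real DIM('a) - 1) * (q (norm x) / norm x) + (p - 2) * q')"
    unfolding ss radial_field_trace[OF x] .
  moreover have "norm (grad w x) = q (norm x)" using gx pos x by (simp add: norm_sgn)
  ultimately show ?thesis by (simp add: algebra_simps)
qed

text \<open>The second order condition at a minimum; no symmetry of \<open>M\<close> is needed.\<close>
lemma local_min_second_derivative:
  fixes d :: "'a::euclidean_space \<Rightarrow> real"
  assumes d: "\<forall>\<^sub>F y in nhds x. (d has_derivative (\<lambda>h. G y \<bullet> h)) (at y)"
    and M: "(G has_derivative M) (at x)" and G: "G x = 0"
    and min: "\<forall>\<^sub>F y in nhds x. d x \<le> d y"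
  shows "M e \<bullet> e \<ge> 0"
proof (rule ccontr)
  assume neg: "\<not> M e \<bullet> e \<ge> 0"
  have l: "((\<lambda>s::real. x + s *\<^sub>R e) has_derivative (\<lambda>s. s *\<^sub>R e)) (at s)" for s
    by (auto intro!: derivative_eq_intros)
  have lim: "filterlim (\<lambda>s::real. x + s *\<^sub>R e) (nhds x) (nhds 0)"
    by (auto intro!: tendsto_eq_intros filterlim_ident)
  have "\<forall>\<^sub>F s in nhds 0. d x \<le> d (x + s *\<^sub>R e) \<and>
       (d has_derivative (\<lambda>h. G (x + s *\<^sub>R e) \<bullet> h)) (at (x + s *\<^sub>R e))"
    using eventually_conj[OF min d] lim by (auto simp: filterlim_iff)
  then obtain \<delta> where \<delta>: "\<delta> > 0" and near: "\<And>s. \<bar>s\<bar> < \<delta> \<Longrightarrow> d x \<le> d (x + s *\<^sub>R e) \<and>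
       (d has_derivative (\<lambda>h. G (x + s *\<^sub>R e) \<bullet> h)) (at (x + s *\<^sub>R e))"
    unfolding eventually_nhds_metric by (auto simp: dist_real_def)
  have g1: "((\<lambda>s. d (x + s *\<^sub>R e)) has_real_derivative (G (x + s *\<^sub>R e) \<bullet> e)) (at s)" if "\<bar>s\<bar> < \<delta>" for s
    using has_derivative_compose[OF l, of d "\<lambda>h. G (x + s *\<^sub>R e) \<bullet> h" s] near[OF that]
    by (simp add: has_field_derivative_def mult_commute_abs)
  interpret M: bounded_linear M using M by (rule has_derivative_bounded_linear)
  have M0: "(G has_derivative M) (at (x + 0 *\<^sub>R e))" using M by simp
  have g2: "((\<lambda>s. G (x + s *\<^sub>R e) \<bullet> e) has_real_derivative (M e \<bullet> e)) (at 0)"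
    using has_derivative_inner_left[OF has_derivative_compose[OF l M0], of e]
    by (simp add: has_field_derivative_def M.scaleR mult_commute_abs)
  \<comment> \<open>If the quadratic form were negative, the derivative of \<open>d\<close> along
    the ray, zero at \<open>x\<close>, would be negative just beyond it. Then \<open>d\<close> would
    decrease strictly there, against minimality.\<close>
  from DERIV_neg_dec_right[OF g2] neg G
  obtain \<eta> where \<eta>: "\<eta> > 0" and dec: "\<And>h. 0 < h \<Longrightarrow> h < \<eta> \<Longrightarrow> G (x + h *\<^sub>R e) \<bullet> e < 0"
    by force
  define s where "s = min \<delta> \<eta> / 2"
  have s: "0 < s" "s < \<delta>" "s < \<eta>" using \<delta> \<eta> by (auto simp: s_def)
  have "d (x + s *\<^sub>R e) < d (x + 0 *\<^sub>R e)"
  proof (rule DERIV_neg_imp_decreasing_open[OF s(1)])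
    show "\<exists>y. ((\<lambda>s. d (x + s *\<^sub>R e)) has_real_derivative y) (at t) \<and> y < 0" if "0 < t" "t < s" for t
      using g1[of t] dec[of t] that s by auto
    show "continuous_on {0..s} (\<lambda>s. d (x + s *\<^sub>R e))"
    proof (rule DERIV_continuous_on)
      fix t assume "t \<in> {0..s}"
      then have "\<bar>t\<bar> < \<delta>" using s by simp
      then show "((\<lambda>s. d (x + s *\<^sub>R e)) has_real_derivative (G (x + t *\<^sub>R e) \<bullet> e)) (at t within {0..s})"
        by (rule has_field_derivative_at_within[OF g1])
    qed
  qed
  moreover have "d x \<le> d (x + s *\<^sub>R e)" using near[of s] s by fastforce
  ultimately show False by simp
qed

section \<open>Touching from below by radial functions\<close>

text \<open>The difference of \<open>w\<close> and the radial function has a local minimum at the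
  contact point, so the gradients agree there and the Hessian difference has a nonnegative quadratic
  form. Since \<open>F1\<close> is positive, the nondivergence form is available, and it is monotone
  in the Hessian.\<close>

lemma p_laplacian_touching:
  fixes w :: "'a::euclidean_space \<Rightarrow> real"
  assumes U: "C2_on_open U w" "x \<in> U" and x: "x \<noteq> 0" and p: "p \<ge> 2"
    and F: "\<forall>\<^sub>F r in nhds (norm x). (F has_real_derivative F1 r) (at r)"
    and F1: "(F1 has_real_derivative F2) (at (norm x))" and pos: "F1 (norm x) > 0"
    and eq: "w x = F (norm x)" and min: "\<forall>\<^sub>F y in nhds x. F (norm y) \<le> w y"
  shows "p_laplacian p w x \<ge> F1 (norm x) powr (p - 2) *
     ((p - 1) * F2 + (real DIM('a) - 1) * F1 (norm x) / norm x)"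
proof -
  define G where "G y = grad w y - F1 (norm y) *\<^sub>R sgn y" for y
  let ?N = "\<lambda>e. (F2 * (sgn x \<bullet> e)) *\<^sub>R sgn x + (F1 (norm x) / norm x) *\<^sub>R (e - (sgn x \<bullet> e) *\<^sub>R sgn x)"
  define M where "M = frechet_derivative (grad w) (at x)"
  have M: "(grad w has_derivative M) (at x)"
    using U by (simp add: C2_on_open_def M_def frechet_derivative_works)
  have lim: "filterlim norm (nhds (norm x)) (nhds x)"
    by (intro tendsto_norm filterlim_ident)
  have "\<forall>\<^sub>F y in nhds x. y \<in> U \<and> y \<noteq> 0 \<and> (F has_real_derivative F1 (norm y)) (at (norm y))"
    using U x F lim unfolding filterlim_iff
    by (intro eventually_conj eventually_nhds_in_open t1_space_nhds) (auto simp: C2_on_open_def)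
  then have d: "\<forall>\<^sub>F y in nhds x. ((\<lambda>y. w y - F (norm y)) has_derivative (\<lambda>h. G y \<bullet> h)) (at y)"
  proof (rule eventually_mono)
    fix y assume y: "y \<in> U \<and> y \<noteq> 0 \<and> (F has_real_derivative F1 (norm y)) (at (norm y))"
    have "((\<lambda>y. F (norm y)) has_derivative (\<lambda>h. F1 (norm y) * (h \<bullet> sgn y))) (at y)"
      using has_derivative_compose[OF has_derivative_norm, of y F] y
      by (simp add: has_field_derivative_def)
    moreover have "(w has_derivative (\<lambda>h. grad w y \<bullet> h)) (at y)"
      using y U by (intro has_derivative_grad) (simp add: C2_on_open_def)
    ultimately show "((\<lambda>y. w y - F (norm y)) has_derivative (\<lambda>h. G y \<bullet> h)) (at y)"
      by (auto intro!: derivative_eq_intros simp: G_def inner_diff_left inner_diff_right inner_commute)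
  qed
  have min': "\<forall>\<^sub>F y in nhds x. w x - F (norm x) \<le> w y - F (norm y)"
    using min by (rule eventually_mono) (simp add: eq)
  have "(\<lambda>h. G x \<bullet> h) = (\<lambda>h. 0)"
    by (rule has_derivative_local_min[OF eventually_nhds_x_imp_x[OF d]])
      (use min' in \<open>auto simp: eventually_at_filter elim: eventually_mono\<close>)
  then have G0: "G x = 0" by (metis inner_eq_zero_iff)
  have GD: "(G has_derivative (\<lambda>e. M e - ?N e)) (at x)"
    unfolding G_def by (intro has_derivative_diff M has_derivative_radial_field F1 x)
  have psd: "?N e \<bullet> e \<le> M e \<bullet> e" for e
    using local_min_second_derivative[OF d GD G0 min', of e] by (simp only: inner_diff_left)
  define \<xi> where "\<xi> = F1 (norm x) *\<^sub>R sgn x"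
  have gx: "grad w x = \<xi>" using G0 by (simp add: G_def \<xi>_def)
  have \<xi>: "\<xi> \<noteq> 0" "norm \<xi> = F1 (norm x)" using pos x by (auto simp: \<xi>_def norm_sgn sgn_zero_iff)
  have s: "sgn x \<bullet> sgn x = 1" using x by (simp add: norm_sgn flip: power2_norm_eq_inner)
  have N\<xi>: "?N \<xi> \<bullet> \<xi> / (norm \<xi>)\<^sup>2 = F2"
    using pos x s by (simp add: \<xi>_def norm_sgn power2_eq_square)
  have "F1 (norm x) powr (p - 2) * ((p - 1) * F2 + (real DIM('a) - 1) * F1 (norm x) / norm x)
     = norm \<xi> powr (p - 2) * ((\<Sum>b\<in>Basis. ?N b \<bullet> b) + (p - 2) * (?N \<xi> \<bullet> \<xi> / (norm \<xi>)\<^sup>2))"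
    unfolding radial_field_trace[OF x] N\<xi> unfolding \<xi>(2) by (simp add: algebra_simps)
  \<comment> \<open>The traces are compared on each basis vector and the second summand on \<xi>,
    where \<open>p - 2\<close> must be nonnegative.\<close>
  also have "\<dots> \<le> norm \<xi> powr (p - 2) * ((\<Sum>b\<in>Basis. M b \<bullet> b) + (p - 2) * (M \<xi> \<bullet> \<xi> / (norm \<xi>)\<^sup>2))"
    using p by (intro mult_left_mono add_mono sum_mono psd divide_right_mono) auto
  also have "\<dots> = p_laplacian p w x"
    using p_laplacian_eq[OF M, of p] gx \<xi> by simp
  finally show ?thesis .
qed

text \<open>By \<open>dom\<close> the quotient F/w is small at infinity, and by \<open>F0\<close> it
  vanishes on the inner sphere, so its positive supremum is attained in between. The operator is
  homogeneous of degree p - 1, hence the multiple of F touching \<open>w\<close> there is again a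
  strict subsolution.\<close>

lemma supersolution_not_above_subsolution:
  fixes w :: "'a::euclidean_space \<Rightarrow> real"
  assumes super: "supersolution p lam r0 w" and wpos: "\<And>x. norm x \<ge> r0 \<Longrightarrow> w x > 0"
    and r0: "r0 > 0" and r1: "r1 \<ge> r0" and p: "p \<ge> 2"
    and cont: "continuous_on {r1..} F" and F0: "F r1 = 0"
    and F: "\<And>r. r > r1 \<Longrightarrow> (F has_real_derivative F1 r) (at r)"
    and F1: "\<And>r. r > r1 \<Longrightarrow> (F1 has_real_derivative F2 r) (at r)"
    and F1pos: "\<And>r. r > r1 \<Longrightarrow> F1 r > 0"
    and sub: "\<And>r. r > r1 \<Longrightarrow> F1 r powr (p - 2) * ((p - 1) * F2 r + (real DIM('a) - 1) * F1 r / r)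
        + lam * r powr (- p) * F r powr (p - 1) > 0"
    and dom: "\<And>\<eta>. \<eta> > 0 \<Longrightarrow> \<forall>\<^sub>F x in at_infinity. F (norm x) < \<eta> * w x"
  shows False
proof -
  obtain U where U: "{x. norm x \<ge> r0} \<subseteq> U" "C2_on_open U w"
    using super by (auto simp: supersolution_def C2_on_def)
  define S where "S = {x::'a. norm x \<ge> r1}"
  have contw: "continuous_on S w"
    using U r1 unfolding S_def C2_on_open_def
    by (intro continuous_at_imp_continuous_on ballI differentiable_imp_continuous_within)
      (auto simp: subset_eq)
  have wS: "w x > 0" if "x \<in> S" for x using that wpos r1 by (auto simp: S_def)
  have Fpos: "F r > 0" if "r > r1" for r
  proof -
    have "F r1 < F r"
      using that F F1pos
      by (intro DERIV_pos_imp_increasing_open[OF that] continuous_on_subset[OF cont]) auto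
    then show ?thesis using F0 by simp
  qed
  define k where "k x = F (norm x) / w x" for x
  have contk: "continuous_on S k"
    unfolding k_def using less_imp_neq[OF wS]
    by (intro continuous_intros contw continuous_on_compose2[OF cont]) (auto simp: S_def)
  obtain e :: 'a where e: "e \<in> Basis" using nonempty_Basis by blast
  define x1 where "x1 = (r1 + 1) *\<^sub>R e"
  have x1: "norm x1 = r1 + 1" using e r0 r1 by (simp add: x1_def)
  have k1: "k x1 > 0" unfolding k_def x1 using Fpos wS[of x1] x1 by (simp add: S_def)
  obtain R where R: "\<And>x. norm x \<ge> R \<Longrightarrow> F (norm x) < k x1 * w x"
    using dom[OF k1] unfolding eventually_at_infinity by blast
  \<comment> \<open>The bound \<open>r1 + 2\<close> puts \<open>x1\<close> into the compact annulus.
    Beyond \<open>R'\<close> the quotient is below \<open>k x1\<close>, so the maximum over the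
    annulus is global.\<close>
  define R' where "R' = max R (r1 + 2)"
  have "compact (S \<inter> cball 0 R')"
    unfolding S_def by (intro closed_Int_compact closed_Collect_le continuous_intros) auto
  moreover have "x1 \<in> S \<inter> cball 0 R'" using x1 by (auto simp: S_def R'_def)
  ultimately obtain x0 where x0: "x0 \<in> S \<inter> cball 0 R'"
    and max: "\<And>x. x \<in> S \<inter> cball 0 R' \<Longrightarrow> k x \<le> k x0"
    using continuous_attains_sup[of "S \<inter> cball 0 R'" k] continuous_on_subset[OF contk] by blast
  have kx: "k x \<le> k x0" if "x \<in> S" for x
  proof (cases "norm x \<le> R'")
    case True then show ?thesis using max that by simp
  next
    case False
    then have "k x < k x1" using R[of x] wS[OF that] by (simp add: k_def R'_def pos_divide_less_eq)
    also have "k x1 \<le> k x0" using max \<open>x1 \<in> S \<inter> cball 0 R'\<close> by blast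
    finally show ?thesis by simp
  qed
  have k0: "k x0 > 0" using k1 kx[of x1] \<open>x1 \<in> S \<inter> cball 0 R'\<close> by force
  define r where "r = norm x0"
  have r: "r > r1"
    using x0 k0 F0 by (cases "norm x0 = r1") (auto simp: k_def S_def r_def)
  \<comment> \<open>The largest factor for which \<open>c * F\<close> stays below \<open>w\<close>
    on \<open>S\<close>; equality holds at \<open>x0\<close>.\<close>
  define c where "c = 1 / k x0"
  have c: "c > 0" using k0 by (simp add: c_def)
  have nb: "\<forall>\<^sub>F y in nhds x0. norm (y::'a) > r1"
    using r by (intro eventually_nhds_in_open[of "{y::'a. norm y > r1}", simplified])
      (auto simp: r_def intro!: open_Collect_less continuous_intros)
  have nr: "\<forall>\<^sub>F s in nhds r. s > r1"
    using r by (intro eventually_nhds_in_open[of "{r1<..}", simplified]) auto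
  have lap: "p_laplacian p w x0 \<ge> (c * F1 r) powr (p - 2) *
     ((p - 1) * (c * F2 r) + (real DIM('a) - 1) * (c * F1 r) / r)"
    unfolding r_def
  proof (rule p_laplacian_touching[OF U(2), where F="\<lambda>s. c * F s" and ?F1.0="\<lambda>s. c * F1 s"])
    show "x0 \<in> U" "x0 \<noteq> 0" using x0 U r1 r0 by (auto simp: S_def)
    show "\<forall>\<^sub>F r in nhds (norm x0). ((\<lambda>s. c * F s) has_real_derivative c * F1 r) (at r)"
      using nr unfolding r_def by (rule eventually_mono) (auto intro!: DERIV_cmult F)
    show "((\<lambda>s. c * F1 s) has_real_derivative c * F2 (norm x0)) (at (norm x0))"
      using F1 r by (auto intro!: DERIV_cmult simp: r_def)
    show "c * F1 (norm x0) > 0" using c F1pos r by (simp add: r_def)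
    show "w x0 = c * F (norm x0)" using k0 wS[of x0] x0 by (auto simp: c_def k_def)
    show "\<forall>\<^sub>F y in nhds x0. c * F (norm y) \<le> w y"
      using nb
    proof (rule eventually_mono)
      fix y :: 'a assume "r1 < norm y"
      then have "k y \<le> k x0" "w y > 0" using kx wS by (auto simp: S_def)
      then show "c * F (norm y) \<le> w y" using k0 by (simp add: c_def k_def[of y] field_simps)
    qed
  qed (use p in auto)
  have hz: "lam * r powr - p * w x0 powr (p - 1) \<le> - p_laplacian p w x0"
  proof -
    have "hardy_op p lam w x0 \<ge> 0" using super r r1 by (simp add: supersolution_def r_def)
    moreover have "w x0 > 0" using wS x0 by blast
    then have "\<bar>w x0\<bar> powr (p - 2) * w x0 = w x0 powr (p - 1)"
      using powr_mult_base[of "w x0" "p-2"] by (simp add: mult.commute)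
    ultimately show ?thesis by (simp add: hardy_op_def r_def)
  qed
  have w0: "w x0 = c * F r" using k0 wS[of x0] x0 by (auto simp: c_def k_def r_def)
  have cp: "c powr (p - 1) = c powr (p - 2) * c"
    using powr_mult_base[of c "p-2"] c by (simp add: mult.commute)
  have "c powr (p - 1) * (F1 r powr (p - 2) * ((p - 1) * F2 r + (real DIM('a) - 1) * F1 r / r)
        + lam * r powr (- p) * F r powr (p - 1))
     = (c * F1 r) powr (p - 2) * ((p - 1) * (c * F2 r) + (real DIM('a) - 1) * (c * F1 r) / r)
        + lam * r powr - p * w x0 powr (p - 1)"
  proof -
    have 1: "w x0 powr (p - 1) = c powr (p - 1) * F r powr (p - 1)"
      using c Fpos[OF r] by (simp add: w0 powr_mult)
    have 2: "(c * F1 r) powr (p - 2) = c powr (p - 2) * F1 r powr (p - 2)"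
      using c F1pos[OF r] by (simp add: powr_mult)
    show ?thesis unfolding 1 2 unfolding cp by (simp add: algebra_simps add_divide_distrib)
  qed
  also have "\<dots> \<le> 0" using lap hz by linarith
  finally show False
    using mult_pos_pos[OF _ sub[OF r], of "c powr (p - 1)"] c by simp
qed

section \<open>Radial subsolutions in logarithmic coordinates\<close>

text \<open>Here \<open>f\<close>, \<open>f1\<close>, \<open>f2\<close> are the values at ln r of a
  profile and its first two derivatives, and y = a + f1/f is the derivative of ln (r^a f(ln r)) with
  respect to ln r. By homogeneity the whole expression is a positive factor \<open>K\<close> times
  the Riccati expression in \<open>ric\<close>, in which \<open>f2 / f - (f1 / f)\<^sup>2\<close> is
  the derivative of f1/f.\<close>

lemma subsolution_log_coordinates:
  fixes a r f f1 f2 p n lam :: real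
  assumes a: "a > 0" and r: "r > 0" and f: "f > 0" and f1: "f1 > 0" and p: "p \<ge> 2"
    and ric: "(p - 1) * (a + f1 / f) powr (p - 2) * (f2 / f - (f1 / f)\<^sup>2)
       + lam - (a + f1 / f) powr (p - 1) * (p - n - (p - 1) * (a + f1 / f)) > 0"
  shows "(r powr (a - 1) * (a * f + f1)) powr (p - 2) *
     ((p - 1) * (r powr (a - 2) * ((a - 1) * (a * f + f1) + a * f1 + f2))
       + (n - 1) * (r powr (a - 1) * (a * f + f1)) / r)
     + lam * r powr (- p) * (r powr a * f) powr (p - 1) > 0"
proof -
  define h where "h = f1 / f"
  define y where "y = a + h"
  define g where "g = f2 / f"
  have h: "h > 0" using f f1 by (simp add: h_def)
  have y: "y > 0" using h a by (simp add: y_def)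
  have e1: "a * f + f1 = f * y" using f by (simp add: y_def h_def field_simps)
  have e2: "(a - 1) * (a * f + f1) + a * f1 + f2 = f * ((a - 1) * y + a * h + g)"
  proof -
    have "f1 = f * h" "f2 = f * g" using f by (simp_all add: h_def g_def)
    then show ?thesis by (simp add: y_def algebra_simps)
  qed
  have e3: "r powr (a - 1) / r = r powr (a - 2)"
    using r powr_diff[of r "a - 1" 1] by simp
  define K where "K = r powr (a * p - a - p) * f powr (p - 1)"
  have K: "K > 0" using r f by (simp add: K_def)
  have fp: "f powr (p - 1) = f powr (p - 2) * f"
    using powr_mult_base[of f "p-2"] f by (simp add: mult.commute)
  have yp: "y powr (p - 1) = y powr (p - 2) * y"
    using powr_mult_base[of y "p-2"] y by (simp add: mult.commute)
  have k1: "(r powr (a - 1) * (f * y)) powr (p - 2) * (r powr (a - 2) * f) = K * y powr (p - 2)"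
  proof -
    have "(r powr (a - 1) * (f * y)) powr (p - 2) = r powr ((a - 1) * (p - 2)) * f powr (p - 2) * y powr (p - 2)"
      using r f y by (simp add: powr_mult powr_powr)
    moreover have "r powr ((a - 1) * (p - 2)) * r powr (a - 2) = r powr (a * p - a - p)"
      by (simp add: powr_add[symmetric] algebra_simps)
    ultimately show ?thesis by (simp add: K_def fp)
  qed
  have k2: "r powr (- p) * (r powr a * f) powr (p - 1) = K"
  proof -
    have "(r powr a * f) powr (p - 1) = r powr (a * (p - 1)) * f powr (p - 1)"
      using r f by (simp add: powr_mult powr_powr)
    moreover have "r powr (- p) * r powr (a * (p - 1)) = r powr (a * p - a - p)"
      by (simp add: powr_add[symmetric] algebra_simps)
    ultimately show ?thesis by (simp add: K_def)
  qed
  have "(r powr (a - 1) * (a * f + f1)) powr (p - 2) *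
     ((p - 1) * (r powr (a - 2) * ((a - 1) * (a * f + f1) + a * f1 + f2))
       + (n - 1) * (r powr (a - 1) * (a * f + f1)) / r)
     + lam * r powr (- p) * (r powr a * f) powr (p - 1)
    = (r powr (a - 1) * (f * y)) powr (p - 2) *
     ((p - 1) * (r powr (a - 2) * (f * ((a - 1) * y + a * h + g)))
       + (n - 1) * ((r powr (a - 1) / r) * (f * y)))
     + lam * (r powr (- p) * (r powr a * f) powr (p - 1))"
    unfolding e2 unfolding e1 by simp
  also have "\<dots> = ((r powr (a - 1) * (f * y)) powr (p - 2) * (r powr (a - 2) * f)) *
       ((p - 1) * ((a - 1) * y + a * h + g) + (n - 1) * y) + lam * K"
    unfolding e3 k2 by (simp add: algebra_simps)
  also have "\<dots> = K * ((p - 1) * y powr (p - 2) * (g - h\<^sup>2) + lam - y powr (p - 1) * (p - n - (p - 1) * y))"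
    unfolding k1 yp by (simp add: y_def algebra_simps power2_eq_square)
  also have "\<dots> > 0" using K ric by (simp add: g_def h_def y_def)
  finally show ?thesis .
qed

section \<open>Riccati inequalities for the two profiles\<close>

lemma powr_minus_3:
  assumes "(y::real) > 0"
  shows "y powr (p - 2) = y powr (p - 3) * y" "y powr (p - 1) = y powr (p - 3) * y * y"
  using assms powr_mult_base[of y "p - 3"] powr_mult_base[of y "p - 2"] by (simp_all add: mult_ac)

text \<open>The slope -\<epsilon> h - h^2 is that of h = f'/f when f'' = -\<epsilon> f'. The
  expression vanishes at h = 0 and increases in h: its derivative is a positive factor times
  \<open>Q\<close>, and the two upper bounds on \<epsilon> make one summand of \<open>Q\<close>
  positive and the other nonnegative.\<close>

lemma riccati_subcritical:
  fixes a p n h \<epsilon> :: real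
  assumes a: "a > 0" and p: "p \<ge> 2" and \<epsilon>: "0 < \<epsilon>" "\<epsilon> < p * a - (p - n)" "\<epsilon> < a" and h: "h > 0"
  shows "(p - 1) * (a + h) powr (p - 2) * (- \<epsilon> * h - h\<^sup>2)
       + a powr (p - 1) * (p - n - (p - 1) * a) - (a + h) powr (p - 1) * (p - n - (p - 1) * (a + h)) > 0"
proof -
  define D where "D h = (p - 1) * (a + h) powr (p - 2) * (- \<epsilon> * h - h\<^sup>2)
     + a powr (p - 1) * (p - n - (p - 1) * a) - (a + h) powr (p - 1) * (p - n - (p - 1) * (a + h))" for h
  have "D 0 < D h"
  proof (rule DERIV_pos_imp_increasing[OF h])
    fix s assume s: "0 \<le> s" "s \<le> h"
    have y: "a + s > 0" using a s by simp
    define Q where "Q = (a + s) * (p * a - (p - n) - \<epsilon>) + (p - 2) * s * (a - \<epsilon>)"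
    have "(a + s) * (p * a - (p - n) - \<epsilon>) > 0" using y \<epsilon> by simp
    moreover have "(p - 2) * s * (a - \<epsilon>) \<ge> 0" using p s \<epsilon> by simp
    ultimately have Q: "Q > 0" by (simp add: Q_def)
    have "(D has_real_derivative ((p - 1) * ((p - 2) * (a + s) powr (p - 3)) * (- \<epsilon> * s - s\<^sup>2)
        + (p - 1) * (a + s) powr (p - 2) * (- \<epsilon> - 2 * s)
        - ((p - 1) * (a + s) powr (p - 2) * (p - n - (p - 1) * (a + s))
           + (a + s) powr (p - 1) * (- (p - 1))))) (at s)"
      unfolding D_def using y
      by (auto intro!: derivative_eq_intros simp: algebra_simps)
    also have "(p - 1) * ((p - 2) * (a + s) powr (p - 3)) * (- \<epsilon> * s - s\<^sup>2)
        + (p - 1) * (a + s) powr (p - 2) * (- \<epsilon> - 2 * s)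
        - ((p - 1) * (a + s) powr (p - 2) * (p - n - (p - 1) * (a + s))
           + (a + s) powr (p - 1) * (- (p - 1))) = (p - 1) * (a + s) powr (p - 3) * Q"
      unfolding powr_minus_3[OF y] Q_def by (simp add: algebra_simps power2_eq_square)
    finally show "\<exists>d. (D has_real_derivative d) (at s) \<and> 0 < d" using Q p y by auto
  qed
  then show ?thesis by (simp add: D_def)
qed

text \<open>
The left-hand side is monotone in the test slope \<open>g\<close>, so it suffices to treat the extremal slope; the
weight \<open>a (p - 2) / (2 a + p h)\<close> makes its \<open>h\<close>-derivative nonnegative.
\<close>
lemma riccati_critical:
  fixes a p n h g :: real
  assumes a: "a > 0" and p: "p \<ge> 2" and an: "p * a = p - n" and h: "h > 0"
    and g: "g > - (h\<^sup>2 * (a * (p - 2) / (2 * a + p * h)))"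
  shows "(p - 1) * (a + h) powr (p - 2) * (g - h\<^sup>2)
       + a powr (p - 1) * (p - n - (p - 1) * a) - (a + h) powr (p - 1) * (p - n - (p - 1) * (a + h)) > 0"
proof -
  define X where "X h = a * (p - 2) / (2 * a + p * h)" for h
  define D where "D h = (p - 1) * (a + h) powr (p - 2) * (- (h\<^sup>2 * X h) - h\<^sup>2)
     + a powr (p - 1) * (p - n - (p - 1) * a) - (a + h) powr (p - 1) * (p - n - (p - 1) * (a + h))" for h
  have "D 0 \<le> D h"
  proof (rule DERIV_nonneg_imp_nondecreasing[of 0 h D])
    show "0 \<le> h" using h by simp
    fix s assume s: "0 \<le> s" "s \<le> h"
    have y: "a + s > 0" using a s by simp
    have d: "2 * a + p * s > 0" using a p s by (intro add_pos_nonneg) auto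
    define X' where "X' = - (a * (p - 2) * p) / (2 * a + p * s)\<^sup>2"
    have X'neg: "X' \<le> 0" using a p by (simp add: X'_def divide_nonpos_nonneg)
    have X': "(X has_real_derivative X') (at s)"
      unfolding X_def X'_def using d
      by (auto intro!: derivative_eq_intros simp: power2_eq_square algebra_simps)
    have Xeq: "X s * (2 * a + p * s) = a * (p - 2)" using d by (simp add: X_def)
    have "(D has_real_derivative ((p - 1) * ((p - 2) * (a + s) powr (p - 3)) * (- (s\<^sup>2 * X s) - s\<^sup>2)
        + (p - 1) * (a + s) powr (p - 2) * (- (2 * s * X s + s\<^sup>2 * X') - 2 * s)
        - ((p - 1) * (a + s) powr (p - 2) * (p - n - (p - 1) * (a + s))
           + (a + s) powr (p - 1) * (- (p - 1))))) (at s)"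
      unfolding D_def using y
      by (auto intro!: derivative_eq_intros X' simp: algebra_simps)
    also have "(p - 1) * ((p - 2) * (a + s) powr (p - 3)) * (- (s\<^sup>2 * X s) - s\<^sup>2)
        + (p - 1) * (a + s) powr (p - 2) * (- (2 * s * X s + s\<^sup>2 * X') - 2 * s)
        - ((p - 1) * (a + s) powr (p - 2) * (p - n - (p - 1) * (a + s))
           + (a + s) powr (p - 1) * (- (p - 1)))
      = (p - 1) * (a + s) powr (p - 3) * (s * (a * (p - 2) - X s * (2 * a + p * s)) - (a + s) * s\<^sup>2 * X')"
      unfolding powr_minus_3[OF y] an[symmetric] by (simp add: algebra_simps power2_eq_square)
    also have "\<dots> = (p - 1) * (a + s) powr (p - 3) * ((a + s) * s\<^sup>2 * - X')"
      unfolding Xeq by simp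
    finally have "(D has_real_derivative (p - 1) * (a + s) powr (p - 3) * ((a + s) * s\<^sup>2 * - X')) (at s)" .
    moreover have "(p - 1) * (a + s) powr (p - 3) * ((a + s) * s\<^sup>2 * - X') \<ge> 0"
      using X'neg p y by (intro mult_nonneg_nonneg) auto
    ultimately show "\<exists>d. (D has_real_derivative d) (at s) \<and> 0 \<le> d" by blast
  qed
  then have "D h \<ge> 0" by (simp add: D_def)
  moreover have "(p - 1) * (a + h) powr (p - 2) * (- (h\<^sup>2 * X h) - h\<^sup>2) < (p - 1) * (a + h) powr (p - 2) * (g - h\<^sup>2)"
    using g p a h by (intro mult_strict_left_mono) (auto simp: X_def)
  ultimately show ?thesis by (simp add: D_def)
qed

section \<open>Growth of arbitrary positive supersolutions\<close>

text \<open>The comparison result for r^a f(ln r), reduced to conditions on the profile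
  \<open>f\<close>. The Riccati condition is asked only where \<open>f\<close> is positive, which is
  everywhere past \<open>t1\<close> because \<open>f\<close> increases from 0.\<close>

lemma supersolution_not_above_log_subsolution:
  fixes w :: "'a::euclidean_space \<Rightarrow> real"
  assumes super: "supersolution p lam r0 w" and wpos: "\<And>x. norm x \<ge> r0 \<Longrightarrow> w x > 0"
    and r0: "r0 > 0" and t1: "t1 \<ge> ln r0" and p: "p \<ge> 2" and a: "a > 0"
    and cont: "continuous_on {t1..} f" and f0: "f t1 = 0"
    and f: "\<And>t. t > t1 \<Longrightarrow> (f has_real_derivative f1 t) (at t)"
    and f1: "\<And>t. t > t1 \<Longrightarrow> (f1 has_real_derivative f2 t) (at t)"
    and f1pos: "\<And>t. t > t1 \<Longrightarrow> f1 t > 0"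
    and ric: "\<And>t. t > t1 \<Longrightarrow> f t > 0 \<Longrightarrow>
       (p - 1) * (a + f1 t / f t) powr (p - 2) * (f2 t / f t - (f1 t / f t)\<^sup>2)
       + lam - (a + f1 t / f t) powr (p - 1) * (p - real DIM('a) - (p - 1) * (a + f1 t / f t)) > 0"
    and dom: "\<And>\<eta>. \<eta> > 0 \<Longrightarrow> \<forall>\<^sub>F x in at_infinity. norm x powr a * f (ln (norm x)) < \<eta> * w x"
  shows False
proof (rule supersolution_not_above_subsolution[OF super wpos r0 _ p])
  have fpos: "f t > 0" if "t > t1" for t
  proof -
    have "f t1 < f t"
      using that f f1pos
      by (intro DERIV_pos_imp_increasing_open[OF that] continuous_on_subset[OF cont]) auto
    then show ?thesis using f0 by simp
  qed
  define F where "F r = r powr a * f (ln r)" for r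
  define F1 where "F1 r = r powr (a - 1) * (a * f (ln r) + f1 (ln r))" for r
  define F2 where "F2 r = r powr (a - 2) * ((a - 1) * (a * f (ln r) + f1 (ln r)) + a * f1 (ln r) + f2 (ln r))" for r
  show "r0 \<le> exp t1" using t1 r0 by (metis exp_le_cancel_iff exp_ln)
  have ge: "t1 \<le> ln r" "r > 0" if "r \<ge> exp t1" for r
    using that by (simp_all add: less_le_trans[OF exp_gt_zero] ln_ge_iff)
  show "continuous_on {exp t1..} F"
    unfolding F_def
    by (intro continuous_intros continuous_on_compose2[OF cont]) (auto dest: ge)
  show "F (exp t1) = 0" by (simp add: F_def f0)
  fix r assume r: "r > exp t1"
  have rp: "r > 0" using ge[of r] r by simp
  have lr: "ln r > t1" using r rp by (metis exp_less_cancel_iff exp_ln)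
  have e1: "r powr a / r = r powr (a - 1)" "r powr (a - 1) / r = r powr (a - 2)"
    using rp powr_diff[of r a 1] powr_diff[of r "a - 1" 1] by simp_all
  have e2: "r powr a = r powr (a - 1) * r" "r powr (a - 1) = r powr (a - 2) * r"
    using rp e1 by (simp_all add: field_simps)
  have ln: "(ln has_real_derivative (1 / r)) (at r)"
    using rp by (auto intro!: derivative_eq_intros)
  have fl: "((\<lambda>r. f (ln r)) has_real_derivative f1 (ln r) * (1 / r)) (at r)"
    by (rule DERIV_chain2[OF f[OF lr] ln])
  have f1l: "((\<lambda>r. f1 (ln r)) has_real_derivative f2 (ln r) * (1 / r)) (at r)"
    by (rule DERIV_chain2[OF f1[OF lr] ln])
  have "(F has_real_derivative (a * r powr (a - 1) * f (ln r) + r powr a * (f1 (ln r) * (1 / r)))) (at r)"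
    unfolding F_def using rp by (auto intro!: derivative_eq_intros fl)
  then show "(F has_real_derivative F1 r) (at r)"
    using rp by (simp add: F1_def e2(1) algebra_simps)
  have "(F1 has_real_derivative ((a - 1) * r powr (a - 2) * (a * f (ln r) + f1 (ln r))
      + r powr (a - 1) * (a * (f1 (ln r) * (1 / r)) + f2 (ln r) * (1 / r)))) (at r)"
    unfolding F1_def using rp by (auto intro!: derivative_eq_intros fl f1l simp: algebra_simps)
  then show "(F1 has_real_derivative F2 r) (at r)"
    using rp by (simp add: F2_def e2(2) algebra_simps)
  show "F1 r > 0"
    unfolding F1_def using rp a fpos[OF lr] f1pos[OF lr] by (intro mult_pos_pos add_pos_pos) auto
  show "F1 r powr (p - 2) * ((p - 1) * F2 r + (real DIM('a) - 1) * F1 r / r)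
        + lam * r powr (- p) * F r powr (p - 1) > 0"
    unfolding F_def F1_def F2_def
    by (rule subsolution_log_coordinates[OF a rp fpos[OF lr] f1pos[OF lr] p ric[OF lr fpos[OF lr]]])
next
  fix \<eta> :: real assume "\<eta> > 0"
  then show "\<forall>\<^sub>F x in at_infinity. norm (x::'a) powr a * f (ln (norm x)) < \<eta> * w x" by (rule dom)
qed

text \<open>The profile 1 - exp (-\<epsilon> (t - t1)) satisfies f'' = -\<epsilon> f' and stays
  below 1, so it inherits the domination assumed for r^a.\<close>

lemma supersolution_growth_subcritical:
  fixes w :: "'a::euclidean_space \<Rightarrow> real"
  assumes super: "supersolution p lam r0 w" and wpos: "\<And>x. norm x \<ge> r0 \<Longrightarrow> w x > 0"
    and r0: "r0 > 0" and p: "p \<ge> 2" and a: "a > 0" "p * a > p - real DIM('a)"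
    and lam: "lam = a powr (p - 1) * (p - real DIM('a) - (p - 1) * a)"
    and dom: "\<And>\<eta>. \<eta> > 0 \<Longrightarrow> \<forall>\<^sub>F x in at_infinity. norm x powr a < \<eta> * w x"
  shows False
proof -
  \<comment> \<open>Half the smaller of the two upper bounds that \<open>riccati_subcritical\<close>
    puts on \<epsilon>.\<close>
  define \<epsilon> where "\<epsilon> = min (p * a - (p - real DIM('a))) a / 2"
  have \<epsilon>: "0 < \<epsilon>" "\<epsilon> < p * a - (p - real DIM('a))" "\<epsilon> < a" using a by (auto simp: \<epsilon>_def)
  define t1 where "t1 = ln r0"
  define f where "f t = 1 - exp (- \<epsilon> * (t - t1))" for t
  define f1 where "f1 t = \<epsilon> * exp (- \<epsilon> * (t - t1))" for t
  define f2 where "f2 t = - \<epsilon> * f1 t" for t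
  show False
  proof (rule supersolution_not_above_log_subsolution[OF super wpos r0 _ p a(1)])
    show "ln r0 \<le> t1" by (simp add: t1_def)
    show "continuous_on {t1..} f" unfolding f_def by (intro continuous_intros)
    show "f t1 = 0" by (simp add: f_def)
    show "(f has_real_derivative f1 t) (at t)" for t
      unfolding f_def f1_def by (auto intro!: derivative_eq_intros)
    show "(f1 has_real_derivative f2 t) (at t)" for t
      unfolding f1_def f2_def by (auto intro!: derivative_eq_intros)
    show "f1 t > 0" for t using \<epsilon> by (simp add: f1_def)
    then have "f1 t / f t > 0" if "f t > 0" for t using that by simp
    from riccati_subcritical[OF a(1) p \<epsilon> this]
    show "(p - 1) * (a + f1 t / f t) powr (p - 2) * (f2 t / f t - (f1 t / f t)\<^sup>2)
       + lam - (a + f1 t / f t) powr (p - 1) * (p - real DIM('a) - (p - 1) * (a + f1 t / f t)) > 0"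
      if "f t > 0" for t
      using that by (simp add: lam f2_def)
    show "\<forall>\<^sub>F x in at_infinity. norm (x::'a) powr a * f (ln (norm x)) < \<eta> * w x" if "\<eta> > 0" for \<eta>
      using dom[OF that]
    proof (rule eventually_mono)
      fix x :: 'a
      have "norm x powr a * f (ln (norm x)) \<le> norm x powr a * 1"
        by (intro mult_left_mono) (auto simp: f_def)
      then show "norm x powr a < \<eta> * w x \<Longrightarrow> norm x powr a * f (ln (norm x)) < \<eta> * w x" by simp
    qed
  qed
qed

lemma supersolution_growth_critical:
  fixes w :: "'a::euclidean_space \<Rightarrow> real"
  assumes super: "supersolution p lam r0 w" and wpos: "\<And>x. norm x \<ge> r0 \<Longrightarrow> w x > 0"
    and r0: "r0 > 0" and p: "p > 2" and a: "a > 0" "p * a = p - real DIM('a)" and \<tau>: "\<tau> > 0"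
    and lam: "lam = a powr (p - 1) * (p - real DIM('a) - (p - 1) * a)"
    and dom: "\<And>\<eta>. \<eta> > 0 \<Longrightarrow> \<forall>\<^sub>F x in at_infinity.
       norm x powr a * ln (norm x) powr (2 / p) * ln (ln (norm x)) powr \<tau> < \<eta> * w x"
  shows False
proof -
  define \<gamma> where "\<gamma> = 2 / p"
  have \<gamma>: "0 < \<gamma>" "\<gamma> < 1" "p * \<gamma> = 2" using p by (auto simp: \<gamma>_def)
  define g where "g t = t powr \<gamma> * ln t powr \<tau>" for t :: real
  define H where "H t = \<gamma> / t + \<tau> / (t * ln t)" for t :: real
  define H' where "H' t = - \<gamma> / t\<^sup>2 - \<tau> / (t\<^sup>2 * ln t) - \<tau> / (t\<^sup>2 * (ln t)\<^sup>2)" for t :: real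
  \<comment> \<open>Since \<gamma> < 1, the derivative \<open>g t * H t\<close> tends to 0 while
    \<open>g\<close> tends to infinity. Past \<open>t1\<close> the two bounds combine to p g H <= p
    <= 2 a g(t1).\<close>
  have gH: "\<forall>\<^sub>F t in at_top. g t * H t < 1"
    unfolding g_def H_def using \<gamma> \<tau> by real_asymp
  have ginf: "\<forall>\<^sub>F t in at_top. g t > p / (2 * a)"
    unfolding g_def using \<gamma> \<tau> by real_asymp
  obtain T where T: "\<And>t. t \<ge> T \<Longrightarrow> g t * H t < 1" "\<And>t. t \<ge> T \<Longrightarrow> g t > p / (2 * a)"
    using eventually_conj[OF gH ginf] unfolding eventually_at_top_linorder by blast
  \<comment> \<open>The entry \<open>exp 1\<close> gives ln t > 1 past \<open>t1\<close>: the powers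
    of \<open>ln t\<close> are then differentiable, and 1 / ln t < 1 as \<open>key\<close>
    requires.\<close>
  define t1 where "t1 = max T (max (exp 1) (ln r0))"
  have t1: "t1 \<ge> T" "t1 \<ge> exp 1" "t1 \<ge> ln r0" by (auto simp: t1_def)
  have t1pos: "t1 > 0" using t1(2) exp_gt_zero[of 1] by linarith
  define f where "f t = g t - g t1" for t
  have L: "t > 0" "ln t > 1" if "t > t1" for t
  proof -
    show "t > 0" using that t1pos by simp
    then show "ln t > 1" using ln_less_cancel_iff[of "exp 1" t] that t1(2) by simp
  qed
  have gpos: "g t > 0" and Hpos: "H t > 0" if "t > t1" for t
  proof -
    have "t > 1" using L[OF that] ln_gt_zero_iff[of t] by linarith
    then show "g t > 0" "H t > 0" using \<gamma> \<tau> by (simp_all add: g_def H_def add_pos_pos)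
  qed
  have gd: "(g has_real_derivative g t * H t) (at t)" if "t > t1" for t
  proof -
    have t: "t > 1" using L[OF that] ln_gt_zero_iff[of t] by linarith
    have "(g has_real_derivative (\<gamma> * t powr (\<gamma> - 1) * ln t powr \<tau>
        + t powr \<gamma> * (\<tau> * ln t powr (\<tau> - 1) * (1 / t)))) (at t)"
      unfolding g_def using t by (auto intro!: derivative_eq_intros)
    also have "\<gamma> * t powr (\<gamma> - 1) * ln t powr \<tau> + t powr \<gamma> * (\<tau> * ln t powr (\<tau> - 1) * (1 / t)) = g t * H t"
      using t by (simp add: g_def H_def powr_diff algebra_simps)
    finally show ?thesis .
  qed
  have Hd: "(H has_real_derivative H' t) (at t)" if "t > t1" for t
  proof -
    have t: "t > 1" using L[OF that] ln_gt_zero_iff[of t] by linarith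
    have "(H has_real_derivative (- \<gamma> / t\<^sup>2 - \<tau> * (ln t + 1) / (t * ln t)\<^sup>2)) (at t)"
      unfolding H_def using t by (auto intro!: derivative_eq_intros simp: power2_eq_square)
    also have "- \<gamma> / t\<^sup>2 - \<tau> * (ln t + 1) / (t * ln t)\<^sup>2 = H' t"
      using t by (simp add: H'_def power2_eq_square field_simps)
    finally show ?thesis .
  qed
  have g2d: "((\<lambda>t. g t * H t) has_real_derivative g t * ((H t)\<^sup>2 + H' t)) (at t)" if "t > t1" for t
    by (rule DERIV_cong[OF DERIV_mult[OF gd[OF that] Hd[OF that]]]) (simp add: algebra_simps power2_eq_square)
  \<comment> \<open>Equivalent to g''/g > -((p - 2) / 2) H^2. The factor (p - 2) / 2 is the value at
    h = 0 of the weight in \<open>riccati_critical\<close>, so this is the slope condition to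
    leading order.\<close>
  have key: "- H' t < (p / 2) * (H t)\<^sup>2" if "t > t1" for t
  proof -
    have t: "ln t > 1" "t > 1" using L[OF that] ln_gt_zero_iff[of t] by linarith+
    define q where "q = 1 / ln t"
    have q: "0 < q" "q < 1" using t by (simp_all add: q_def)
    have "- H' t * t\<^sup>2 = \<gamma> + \<tau> * q + \<tau> * q\<^sup>2"
      using t by (simp add: H'_def q_def field_simps power2_eq_square)
    also have "\<dots> < \<gamma> + \<tau> * q + \<tau> * q"
      using q \<tau> by (simp add: power2_eq_square)
    \<comment> \<open>As p \<gamma> = 2, the constant terms and the terms linear in \<open>q\<close>
      agree on both sides, and only a square is left over. This is what singles out the exponent
      2/p; strictness came from q^2 < q.\<close>
    also have "\<dots> \<le> (p / 2) * (\<gamma> + \<tau> * q)\<^sup>2"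
    proof -
      have "(p / 2) * (\<gamma> + \<tau> * q)\<^sup>2 = (p * \<gamma>) / 2 * \<gamma> + (p * \<gamma>) * (\<tau> * q) + (p / 2) * (\<tau> * q)\<^sup>2"
        by (simp add: power2_eq_square algebra_simps)
      also have "\<dots> \<ge> \<gamma> + \<tau> * q + \<tau> * q" using p unfolding \<gamma>(3) by simp
      finally show ?thesis .
    qed
    also have "\<dots> = (p / 2) * (H t)\<^sup>2 * t\<^sup>2"
      using t by (simp add: H_def q_def field_simps power2_eq_square)
    finally show ?thesis using t by (subst (asm) mult_less_cancel_right_pos) auto
  qed
  show False
  proof (rule supersolution_not_above_log_subsolution[OF super wpos r0 t1(3) _ a(1)])
    show "2 \<le> p" using p by simp
    have "t1 > 1" using t1(2) one_less_exp_iff[of "1::real"] by linarith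
    then show "continuous_on {t1..} f"
      unfolding f_def g_def by (intro continuous_intros) auto
    show "f t1 = 0" by (simp add: f_def)
    show fd: "(f has_real_derivative g t * H t) (at t)" if "t > t1" for t
      unfolding f_def by (rule DERIV_cong[OF DERIV_diff[OF gd[OF that] DERIV_const]]) simp
    show "((\<lambda>t. g t * H t) has_real_derivative g t * ((H t)\<^sup>2 + H' t)) (at t)" if "t > t1" for t
      by (rule g2d[OF that])
    show g1pos: "g t * H t > 0" if "t > t1" for t using gpos Hpos that by simp
    show "(p - 1) * (a + g t * H t / f t) powr (p - 2) * (g t * ((H t)\<^sup>2 + H' t) / f t - (g t * H t / f t)\<^sup>2)
       + lam - (a + g t * H t / f t) powr (p - 1) * (p - real DIM('a) - (p - 1) * (a + g t * H t / f t)) > 0"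
      if t: "t > t1" and ft: "f t > 0" for t
    proof -
      define h where "h = g t * H t / f t"
      have h: "h > 0" using g1pos[OF t] ft by (simp add: h_def)
      have d: "2 * a + p * h > 0" using a p h by (intro add_pos_pos) auto
      have "g t * ((H t)\<^sup>2 + H' t) / f t > - (h\<^sup>2 * (a * (p - 2) / (2 * a + p * h)))"
      proof (cases "(H t)\<^sup>2 + H' t \<ge> 0")
        case True
        have "h\<^sup>2 * (a * (p - 2) / (2 * a + p * h)) > 0" using h a p d by simp
        moreover have "g t * ((H t)\<^sup>2 + H' t) / f t \<ge> 0" using True ft gpos[OF t] by simp
        ultimately show ?thesis by linarith
      next
        case False
        define c where "c = - ((H t)\<^sup>2 + H' t)"
        have c: "c > 0" "2 * c < (p - 2) * (H t)\<^sup>2" using False key[OF t] by (auto simp: c_def algebra_simps)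
        txt \<open>Subtracting \<open>g t1\<close> absorbs the term with \<open>p h\<close> in the denominator, because \<open>t1\<close> is large.\<close>
        have "p * (g t * H t) \<le> p * 1" using T(1)[of t] t t1 p by (intro mult_left_mono) auto
        also have "p * 1 \<le> 2 * a * g t1" using T(2)[of t1] t1 a by (simp add: field_simps)
        finally have "2 * a * f t + p * (g t * H t) \<le> 2 * a * g t"
          by (simp add: f_def algebra_simps)
        then have "c * (2 * a * f t + p * (g t * H t)) \<le> c * (2 * a * g t)"
          using c by (intro mult_left_mono) auto
        also have "\<dots> = a * g t * (2 * c)" by simp
        also have "\<dots> < a * g t * ((p - 2) * (H t)\<^sup>2)"
          using c a gpos[OF t] by (intro mult_strict_left_mono) auto
        finally have main: "c * (2 * a * f t + p * (g t * H t)) < a * g t * ((p - 2) * (H t)\<^sup>2)" .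
        have hf: "h * f t = g t * H t" using ft by (simp add: h_def)
        have "(g t * c / f t) * (2 * a + p * h) = g t * (c * (2 * a * f t + p * (g t * H t))) / (f t)\<^sup>2"
          unfolding hf[symmetric] using ft by (simp add: power2_eq_square field_simps)
        also have "\<dots> < g t * (a * g t * ((p - 2) * (H t)\<^sup>2)) / (f t)\<^sup>2"
          using main gpos[OF t] ft by (intro divide_strict_right_mono mult_strict_left_mono) auto
        also have "\<dots> = h\<^sup>2 * (a * (p - 2))"
          by (simp add: h_def power2_eq_square)
        finally have "g t * c / f t < h\<^sup>2 * (a * (p - 2) / (2 * a + p * h))"
          using d by (simp add: pos_less_divide_eq)
        moreover have "g t * ((H t)\<^sup>2 + H' t) / f t = - (g t * c / f t)"
          unfolding c_def by (simp only: mult_minus_right minus_divide_left minus_minus)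
        ultimately show ?thesis by linarith
      qed
      from riccati_critical[OF a(1) _ a(2) h this] show ?thesis
        using p by (simp add: lam h_def)
    qed
    show "\<forall>\<^sub>F x in at_infinity. norm (x::'a) powr a * f (ln (norm x)) < \<eta> * w x" if "\<eta> > 0" for \<eta>
      using dom[OF that]
    proof (rule eventually_mono)
      fix x :: 'a
      have "norm x powr a * f (ln (norm x)) \<le> norm x powr a * g (ln (norm x))"
        by (intro mult_left_mono) (auto simp: f_def g_def)
      then show "norm x powr a * ln (norm x) powr (2 / p) * ln (ln (norm x)) powr \<tau> < \<eta> * w x \<Longrightarrow>
          norm x powr a * f (ln (norm x)) < \<eta> * w x" by (simp add: g_def \<gamma>_def mult.assoc)
    qed
  qed
qed

text \<open>Turns the negation of the conclusion of (b) into the hypothesis \<open>dom\<close> of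
  the two growth lemmas; positivity of \<open>w\<close> clears the denominator.\<close>

lemma Limsup_not_pos_dominated:
  fixes w :: "'a::euclidean_space \<Rightarrow> real"
  assumes "\<not> Limsup at_infinity (\<lambda>x. ereal (\<psi> x / w x)) > 0"
    and wpos: "\<And>x. norm x \<ge> r0 \<Longrightarrow> w x > 0" and "\<eta> > 0"
  shows "\<forall>\<^sub>F x in at_infinity. \<psi> x < \<eta> * w x"
proof -
  have "Limsup at_infinity (\<lambda>x. ereal (\<psi> x / w x)) < ereal \<eta>"
    using assms(1,3) by (metis le_less_trans not_less ereal_less(2))
  then have "\<forall>\<^sub>F x in at_infinity. \<psi> x / w x < \<eta>"
    by (auto dest: Limsup_lessD)
  moreover have "\<forall>\<^sub>F x in at_infinity. w x > 0"
    unfolding eventually_at_infinity using wpos by blast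
  ultimately show ?thesis
    by eventually_elim (simp add: pos_divide_less_eq)
qed

section \<open>Radial increasing supersolutions\<close>

text \<open>If y = r \<phi>'/\<phi> were below \<open>al\<close> at \<open>rs\<close>, it would
  never rise above \<open>y rs\<close> afterwards. On [0, y rs] the function \<open>E\<close> stays
  below \<open>lam\<close> by a fixed gap \<kappa>, so y^(p-1) + \<kappa> ln r is nonincreasing and
  y^(p-1) would be exhausted at a finite radius.\<close>

lemma riccati_lower_bound:
  fixes \<phi> \<rho> \<rho>' :: "real \<Rightarrow> real" and p n lam al r0 :: real
  assumes r0: "r0 > 0" and p: "p > 2"
    and \<phi>: "\<And>r. r > r0 \<Longrightarrow> \<phi> r > 0" and \<rho>: "\<And>r. r > r0 \<Longrightarrow> \<rho> r > 0"
    and d\<phi>: "\<And>r. r > r0 \<Longrightarrow> (\<phi> has_real_derivative \<rho> r) (at r)"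
    and d\<rho>: "\<And>r. r > r0 \<Longrightarrow> (\<rho> has_real_derivative \<rho>' r) (at r)"
    and sup: "\<And>r. r > r0 \<Longrightarrow> \<rho> r powr (p - 2) * ((p - 1) * \<rho>' r + (n - 1) * \<rho> r / r)
        + lam * r powr (- p) * \<phi> r powr (p - 1) \<le> 0"
    and al: "\<And>y. 0 \<le> y \<Longrightarrow> y < al \<Longrightarrow> y powr (p - 1) * (p - n - (p - 1) * y) < lam"
    and rs: "rs > r0"
  shows "rs * \<rho> rs / \<phi> rs \<ge> al"
proof (rule ccontr)
  define E where "E y = y powr (p - 1) * (p - n - (p - 1) * y)" for y
  define y where "y r = r * \<rho> r / \<phi> r" for r
  define y' where "y' r = (\<rho> r + r * \<rho>' r) / \<phi> r - r * (\<rho> r)\<^sup>2 / (\<phi> r)\<^sup>2" for r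
  have ypos: "y r > 0" if "r > r0" for r
    using \<phi>[OF that] \<rho>[OF that] that r0 by (simp add: y_def)
  have dy: "(y has_real_derivative y' r) (at r)" if "r > r0" for r
    unfolding y_def y'_def using \<phi>[OF that]
    by (auto intro!: derivative_eq_intros d\<phi> d\<rho> that simp: field_simps power2_eq_square)
  have ric: "(p - 1) * y r powr (p - 2) * y' r \<le> (E (y r) - lam) / r" if r: "r > r0" for r
  proof -
    have pos: "r > 0" "\<phi> r > 0" "\<rho> r > 0" "y r > 0" using r r0 \<phi> \<rho> ypos by auto
    define g where "g = r\<^sup>2 * \<rho>' r / \<phi> r"
    have yp: "y r powr (p - 1) = y r powr (p - 2) * y r"
      using powr_mult_base[of "y r" "p-2"] pos by (simp add: mult.commute)
    have y2: "y r powr (p - 2) * (\<phi> r / r) powr (p - 2) = \<rho> r powr (p - 2)"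
      using pos by (subst powr_mult[symmetric]) (auto simp: y_def)
    \<comment> \<open>Multiplication by this factor turns the zero order term into the constant
      \<open>lam\<close> and the rest into an expression in \<open>y r\<close> and
      \<open>g\<close>.\<close>
    define K where "K = r powr p * \<phi> r powr - (p - 1)"
    have K: "K > 0" using pos by (simp add: K_def)
    have rp: "r powr p = r powr (p - 2) * r\<^sup>2"
      using pos by (simp add: powr_diff)
    have fp: "\<phi> r powr - (p - 1) = 1 / (\<phi> r powr (p - 2) * \<phi> r)"
      using powr_mult_base[of "\<phi> r" "p-2"] pos
      by (simp only: powr_minus) (simp add: inverse_eq_divide mult.commute)
    have k1: "K * \<rho> r powr (p - 2) = y r powr (p - 2) * (r\<^sup>2 / \<phi> r)"
      unfolding K_def rp fp y2[symmetric] using pos by (simp add: powr_divide)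
    have k2: "K * (r powr (- p) * \<phi> r powr (p - 1)) = 1"
    proof -
      have "r powr p * r powr (- p) = 1" "\<phi> r powr - (p - 1) * \<phi> r powr (p - 1) = 1"
        unfolding powr_add[symmetric] using pos by simp_all
      then show ?thesis by (simp only: K_def mult_ac)
    qed
    have "K * (\<rho> r powr (p - 2) * ((p - 1) * \<rho>' r + (n - 1) * \<rho> r / r)
        + lam * r powr (- p) * \<phi> r powr (p - 1)) \<le> 0"
      using K sup[OF r] by (simp add: mult_nonneg_nonpos)
    also have "K * (\<rho> r powr (p - 2) * ((p - 1) * \<rho>' r + (n - 1) * \<rho> r / r)
        + lam * r powr (- p) * \<phi> r powr (p - 1))
      = (K * \<rho> r powr (p - 2)) * ((p - 1) * \<rho>' r + (n - 1) * \<rho> r / r)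
        + lam * (K * (r powr (- p) * \<phi> r powr (p - 1)))" by (simp add: algebra_simps)
    also have "\<dots> = y r powr (p - 2) * ((p - 1) * g + (n - 1) * y r) + lam"
      unfolding k1 k2 using pos by (simp add: g_def y_def field_simps power2_eq_square)
    finally have le: "y r powr (p - 2) * ((p - 1) * g + (n - 1) * y r) + lam \<le> 0" .
    have "r * y' r = y r + g - (y r)\<^sup>2"
      using pos by (simp add: y'_def y_def g_def field_simps power2_eq_square)
    then have "r * ((p - 1) * y r powr (p - 2) * y' r) = (p - 1) * y r powr (p - 2) * (y r + g - (y r)\<^sup>2)"
      by (metis mult.left_commute)
    also have "\<dots> \<le> E (y r) - lam"
      using le unfolding E_def yp by (simp add: algebra_simps power2_eq_square)
    finally show ?thesis using pos by (simp add: pos_le_divide_eq mult.commute)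
  qed
  have y'neg: "y' r < 0" if r: "r > r0" and less: "y r < al" for r
  proof -
    have "(E (y r) - lam) / r < 0"
      using al[of "y r"] ypos[OF r] r r0 less by (simp add: E_def divide_neg_pos)
    with ric[OF r] have "(p - 1) * y r powr (p - 2) * y' r < 0" by linarith
    then show ?thesis using p ypos[OF r] by (simp add: mult_less_0_iff)
  qed
  assume "\<not> al \<le> rs * \<rho> rs / \<phi> rs"
  then have ys: "y rs < al" by (simp add: y_def)
  have conty: "continuous_on {rs..b} y" for b
    using rs by (intro continuous_at_imp_continuous_on ballI DERIV_isCont[OF dy]) auto
  \<comment> \<open>A rise above \<open>y rs\<close> would keep the minimum over [rs, r] away from
    the right endpoint. At the minimum \<open>y\<close> is below \<open>al\<close>, hence still
    decreasing to the right.\<close>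
  have below: "y r \<le> y rs" if r: "r \<ge> rs" for r
  proof (rule ccontr)
    assume above: "\<not> y r \<le> y rs"
    obtain m where m: "m \<in> {rs..r}" and min: "\<And>s. s \<in> {rs..r} \<Longrightarrow> y m \<le> y s"
      using continuous_attains_inf[OF compact_Icc _ conty, of r] r by auto
    have ym: "y m < al" using min[of rs] ys r by simp
    have mr0: "m > r0" using m rs by simp
    have "m \<noteq> r" using min[of rs] above r by auto
    have neg: "y' m < 0" by (rule y'neg[OF mr0 ym])
    obtain d where d: "d > 0" "\<And>h. 0 < h \<Longrightarrow> h < d \<Longrightarrow> y (m + h) < y m"
      using DERIV_neg_dec_right[OF dy[OF mr0] neg] by blast
    define h where "h = min d (r - m) / 2"
    have h: "0 < h" "h < d" "h \<le> r - m"
      using d(1) m \<open>m \<noteq> r\<close> by (auto simp: h_def)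
    then have "y (m + h) < y m" "m + h \<in> {rs..r}" using d(2) m by auto
    with min[of "m + h"] show False by simp
  qed
  \<comment> \<open>Compactness makes the gap between \<open>E\<close> and \<open>lam\<close>
    uniform. The endpoint 0 is included because \<open>y\<close> might approach it.\<close>
  have "continuous_on {0..y rs} E"
    unfolding E_def using p by (intro continuous_intros continuous_on_powr') auto
  then obtain y0 where y0: "y0 \<in> {0..y rs}" and E0: "\<And>s. s \<in> {0..y rs} \<Longrightarrow> E s \<le> E y0"
    using continuous_attains_sup[OF compact_Icc, of 0 "y rs" E] ypos[OF rs] by auto
  define \<kappa> where "\<kappa> = lam - E y0"
  have \<kappa>: "\<kappa> > 0" using al[of y0] y0 ys by (simp add: \<kappa>_def E_def)
  \<comment> \<open>At this radius the growth of \<kappa> ln r has used up exactly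
    y(rs)^(p-1).\<close>
  define R where "R = rs * exp (y rs powr (p - 1) / \<kappa>)"
  have rs0: "rs > 0" using rs r0 by simp
  have "rs \<le> R" using rs0 \<kappa> by (simp add: R_def)
  have "y R powr (p - 1) + \<kappa> * ln R \<le> y rs powr (p - 1) + \<kappa> * ln rs"
  proof (rule DERIV_nonpos_imp_nonincreasing[OF \<open>rs \<le> R\<close>])
    fix r assume r: "rs \<le> r" "r \<le> R"
    have rr: "r > r0" "r > 0" using r rs rs0 by auto
    have "((\<lambda>r. y r powr (p - 1) + \<kappa> * ln r) has_real_derivative
        ((p - 1) * y r powr (p - 2) * y' r + \<kappa> / r)) (at r)"
      using rr ypos[OF rr(1)] dy[OF rr(1)] by (auto intro!: derivative_eq_intros)
    moreover have "(E (y r) - lam) / r \<le> - \<kappa> / r"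
      using E0[of "y r"] below[OF r(1)] ypos[OF rr(1)] rr by (intro divide_right_mono) (auto simp: \<kappa>_def)
    then have "(p - 1) * y r powr (p - 2) * y' r + \<kappa> / r \<le> 0" using ric[OF rr(1)] by simp
    ultimately show "\<exists>d. ((\<lambda>r. y r powr (p - 1) + \<kappa> * ln r) has_real_derivative d) (at r) \<and> d \<le> 0"
      by blast
  qed
  moreover have "\<kappa> * ln R = \<kappa> * ln rs + y rs powr (p - 1)"
    using rs0 \<kappa> by (simp add: R_def ln_mult algebra_simps)
  ultimately have "y R powr (p - 1) \<le> 0" by simp
  moreover have "y R > 0" using ypos \<open>rs \<le> R\<close> rs by simp
  ultimately show False by simp
qed

lemma radial_supersolution_lower_bound:
  fixes v :: "'a::euclidean_space \<Rightarrow> real"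
  assumes r0: "r0 > 0" and p: "p > 2"
    and vpos: "\<And>x. norm x \<ge> r0 \<Longrightarrow> v x > 0" and rad: "radial_strict_incr r0 v"
    and super: "supersolution p lam r0 v"
    and al: "\<And>y. 0 \<le> y \<Longrightarrow> y < al \<Longrightarrow> y powr (p - 1) * (p - real DIM('a) - (p - 1) * y) < lam"
  shows "\<exists>C>0. \<forall>x. norm x \<ge> r0 \<longrightarrow> norm x powr al \<le> C * v x"
proof -
  obtain \<phi> where v\<phi>: "\<And>x. norm x \<ge> r0 \<Longrightarrow> v x = \<phi> (norm x)"
    and d\<phi>': "\<And>r. r \<ge> r0 \<Longrightarrow> \<exists>d>0. (\<phi> has_real_derivative d) (at r within {r0..})"
    using rad by (auto simp: radial_strict_incr_def)
  obtain U where U: "{x. norm x \<ge> r0} \<subseteq> U" "C2_on_open U v"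
    using super by (auto simp: supersolution_def C2_on_def)
  obtain e :: 'a where "e \<in> Basis" using nonempty_Basis by blast
  then have e: "norm e = 1" "e \<bullet> e = 1" by auto
  \<comment> \<open>Radial monotonicity provides only a first derivative of \<phi>. The second is
    obtained from the Hessian of \<open>v\<close> along the ray through \<open>e\<close>, with
    \<rho> = \<phi>' expressed by the gradient.\<close>
  define \<rho> where "\<rho> r = grad v (r *\<^sub>R e) \<bullet> e" for r
  define \<rho>' where "\<rho>' r = frechet_derivative (grad v) (at (r *\<^sub>R e)) e \<bullet> e" for r
  have interior: "(\<phi> has_real_derivative d) (at r)"
    if "(\<phi> has_real_derivative d) (at r within {r0..})" "r > r0" for r d
    using that at_within_interior[of r "{r0..}"] by simp
  have gradv: "grad v x = d *\<^sub>R sgn x"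
    if d: "(\<phi> has_real_derivative d) (at (norm x))" and x: "norm x > r0" for x d
  proof (rule grad_eqI)
    have x0: "x \<noteq> 0" using x r0 by auto
    have "((\<lambda>y. \<phi> (norm y)) has_derivative (\<lambda>h. d * (h \<bullet> sgn x))) (at x)"
      using has_derivative_compose[OF has_derivative_norm[OF x0], of \<phi>] d
      by (simp add: has_field_derivative_def)
    then have "(v has_derivative (\<lambda>h. d * (h \<bullet> sgn x))) (at x)"
      by (rule has_derivative_transform_within_open[where s="{y. norm y > r0}"])
        (use x v\<phi> in \<open>auto intro!: open_Collect_less continuous_intros\<close>)
    then show "(v has_derivative (\<lambda>h. d *\<^sub>R sgn x \<bullet> h)) (at x)"
      by (simp add: inner_commute)
  qed
  have \<rho>: "(\<phi> has_real_derivative \<rho> r) (at r) \<and> \<rho> r > 0" if r: "r > r0" for r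
  proof -
    obtain d where d: "d > 0" "(\<phi> has_real_derivative d) (at r)"
      using d\<phi>'[of r] interior[OF _ r] r by auto
    have "grad v (r *\<^sub>R e) = d *\<^sub>R e"
      using gradv[of d "r *\<^sub>R e"] d r r0 e by (simp add: sgn_div_norm)
    then show ?thesis using d e by (simp add: \<rho>_def)
  qed
  have d\<rho>: "(\<rho> has_real_derivative \<rho>' r) (at r)" if r: "r > r0" for r
  proof -
    have M: "(grad v has_derivative frechet_derivative (grad v) (at (r *\<^sub>R e))) (at (r *\<^sub>R e))"
      using U r r0 e by (subst frechet_derivative_works[symmetric]) (auto simp: C2_on_open_def subset_eq)
    interpret M: bounded_linear "frechet_derivative (grad v) (at (r *\<^sub>R e))"
      using M by (rule has_derivative_bounded_linear)
    have "((\<lambda>r. r *\<^sub>R e) has_derivative (\<lambda>s. s *\<^sub>R e)) (at r)"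
      by (auto intro!: derivative_eq_intros)
    from has_derivative_inner_left[OF has_derivative_compose[OF this M], of e]
    show ?thesis
      by (simp add: has_field_derivative_def \<rho>_def[abs_def] \<rho>'_def M.scaleR mult_commute_abs)
  qed
  have \<phi>pos: "\<phi> r > 0" if "r \<ge> r0" for r
    using vpos[of "r *\<^sub>R e"] v\<phi>[of "r *\<^sub>R e"] that r0 e by simp
  have sup: "\<rho> r powr (p - 2) * ((p - 1) * \<rho>' r + (real DIM('a) - 1) * \<rho> r / r)
        + lam * r powr (- p) * \<phi> r powr (p - 1) \<le> 0" if r: "r > r0" for r
  proof -
    define x where "x = r *\<^sub>R e"
    have x: "norm x = r" "x \<noteq> 0" using r r0 e by (auto simp: x_def)
    have "\<forall>\<^sub>F y in nhds x. norm y > r0"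
      using r x by (intro eventually_nhds_in_open[of "{y::'a. norm y > r0}", simplified])
        (auto intro!: open_Collect_less continuous_intros)
    then have "\<forall>\<^sub>F y in nhds x. grad v y = \<rho> (norm y) *\<^sub>R sgn y"
      by (rule eventually_mono) (use gradv \<rho> in auto)
    from p_laplacian_radial[OF this, of "\<rho>' r" p] d\<rho>[OF r] \<rho>[OF r] x
    have "p_laplacian p v x = \<rho> r powr (p - 2) * ((p - 1) * \<rho>' r + (real DIM('a) - 1) * \<rho> r / r)"
      by simp
    moreover have "hardy_op p lam v x \<ge> 0" using super r x by (simp add: supersolution_def)
    moreover have "v x = \<phi> r" using v\<phi>[of x] x r by simp
    moreover have "\<bar>\<phi> r\<bar> powr (p - 2) * \<phi> r = \<phi> r powr (p - 1)"
      using powr_mult_base[of "\<phi> r" "p-2"] \<phi>pos[of r] r by (simp add: mult.commute)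
    ultimately show ?thesis by (simp add: hardy_op_def x)
  qed
  have bound: "r * \<rho> r / \<phi> r \<ge> al" if "r > r0" for r
    by (rule riccati_lower_bound[OF r0 p _ _ _ d\<rho> sup al that]) (use \<rho> \<phi>pos in auto)
  \<comment> \<open>The bound r \<phi>'/\<phi> >= al, integrated in ln r; exponentiating it yields
    the constant r0^al / \<phi>(r0).\<close>
  have mono: "ln (\<phi> r0) - al * ln r0 \<le> ln (\<phi> r) - al * ln r" if r: "r \<ge> r0" for r
  proof (rule DERIV_nonneg_imp_increasing_open[OF r, of "\<lambda>r. ln (\<phi> r) - al * ln r"])
    fix s assume s: "r0 < s" "s < r"
    have "((\<lambda>r. ln (\<phi> r) - al * ln r) has_real_derivative (\<rho> s / \<phi> s - al / s)) (at s)"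
      using s r0 \<phi>pos[of s] \<rho>[OF s(1)] by (auto intro!: derivative_eq_intros)
    moreover have "\<rho> s / \<phi> s - al / s \<ge> 0"
      using bound[OF s(1)] s r0 \<phi>pos[of s] by (simp add: field_simps)
    ultimately show "\<exists>y. ((\<lambda>r. ln (\<phi> r) - al * ln r) has_real_derivative y) (at s) \<and> 0 \<le> y" by blast
  next
    \<comment> \<open>The one-sided derivative at \<open>r0\<close> gives continuity up to the
      boundary sphere, from which the integration starts.\<close>
    have "continuous_on {r0..} \<phi>"
      using d\<phi>' by (force simp: continuous_on_eq_continuous_within intro: DERIV_continuous)
    then have "continuous_on {r0..r} \<phi>" by (rule continuous_on_subset) auto
    then show "continuous_on {r0..r} (\<lambda>r. ln (\<phi> r) - al * ln r)"
      using r0 less_imp_neq[OF \<phi>pos] by (intro continuous_intros) force+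
  qed
  have "norm x powr al \<le> (r0 powr al / \<phi> r0) * v x" if x: "norm x \<ge> r0" for x
  proof -
    have pos: "\<phi> (norm x) > 0" "\<phi> r0 > 0" "norm x > 0" using \<phi>pos x r0 by auto
    have "ln (norm x powr al * \<phi> r0) \<le> ln (r0 powr al * \<phi> (norm x))"
      using mono[OF x] pos r0 by (simp add: ln_mult ln_powr)
    then have "norm x powr al * \<phi> r0 \<le> r0 powr al * \<phi> (norm x)"
      using pos r0 by (subst (asm) ln_le_cancel_iff) auto
    then show ?thesis using pos v\<phi>[OF x] by (simp add: field_simps)
  qed
  then show ?thesis using r0 \<phi>pos[of r0] by (intro exI[of _ "r0 powr al / \<phi> r0"]) auto
qed

section \<open>The exponents\<close>

lemma strict_supersolution_imp_supersolution:
  "strict_supersolution p lam r0 v \<Longrightarrow> supersolution p lam r0 v"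
  by (auto simp: strict_supersolution_def supersolution_def less_imp_le)

lemma expo_fun_nonneg:
  assumes "\<alpha> \<ge> 0"
  shows "expo_fun p N \<alpha> = \<alpha> powr (p - 1) * (p - N - (p - 1) * \<alpha>)"
  using powr_mult_base[OF assms, of "p - 2"] assms by (simp add: expo_fun_def)

text \<open>At \<alpha> = (p - N) / p the linear factor p - N - (p - 1) \<alpha> equals \<alpha>
  itself, so the value is \<alpha>^p.\<close>

lemma expo_fun_max: "p > N \<Longrightarrow> p > 2 \<Longrightarrow> expo_fun p N ((p - N) / p) = C_H p N"
  using powr_mult_base[of "(p - N) / p" "p - 1"]
  by (simp add: expo_fun_nonneg C_H_def field_simps)

lemma continuous_on_expo_fun: "p > 2 \<Longrightarrow> continuous_on S (expo_fun p N)"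
  unfolding expo_fun_def by (intro continuous_intros continuous_on_powr') auto

theorem theorem4p2:
  fixes p r0 lam al alb :: real
  assumes dim: "DIM('a::euclidean_space) \<ge> 2"
    and p2: "p \<ge> 2" and pN: "p > real DIM('a)"
    and r0: "r0 > 0"
    and lam: "0 \<le> lam" "lam \<le> C_H p (real DIM('a))"
    and roots: "{\<alpha> \<in> {0 .. (p - real DIM('a)) / (p - 1)}. expo_fun p (real DIM('a)) \<alpha> = lam} = {al, alb}"
    and ord: "al \<le> alb"
  shows
    "(\<forall>v :: 'a \<Rightarrow> real.
        (\<forall>x. norm x \<ge> r0 \<longrightarrow> v x > 0) \<and> radial_strict_incr r0 v \<and>
        strict_supersolution p lam r0 v \<longrightarrow>
        (\<exists>C>0. \<forall>x. norm x \<ge> r0 \<longrightarrow> norm x powr al \<le> C * v x))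
   \<and> (\<forall>w :: 'a \<Rightarrow> real.
        (\<forall>x. norm x \<ge> r0 \<longrightarrow> w x > 0) \<and> supersolution p lam r0 w \<longrightarrow>
        (lam < C_H p (real DIM('a)) \<longrightarrow>
           Limsup at_infinity (\<lambda>x. ereal (norm x powr alb / w x)) > 0)
      \<and> (lam = C_H p (real DIM('a)) \<longrightarrow>
           (\<forall>\<tau>>0. Limsup at_infinity
              (\<lambda>x. ereal (norm x powr ((p - real DIM('a)) / p) * ln (norm x) powr (2 / p)
                           * ln (ln (norm x)) powr \<tau> / w x)) > 0)))"
proof -
  define N where "N = real DIM('a)"
  define a where "a = (p - N) / p"
  define b where "b = (p - N) / (p - 1)"
  have N: "N \<ge> 2" "p > N" using dim pN by (auto simp: N_def)
  have p: "p > 2" using N by simp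
  have a: "0 < a" "a \<le> b" "p * a = p - N" using N p by (auto simp: a_def b_def frac_le)
  have roots': "\<alpha> \<in> {0..b} \<and> expo_fun p N \<alpha> = lam \<longleftrightarrow> \<alpha> = al \<or> \<alpha> = alb" for \<alpha>
    using roots unfolding N_def[symmetric] b_def[symmetric] by blast
  have al_alb: "al \<in> {0..b}" "alb \<in> {0..b}" "expo_fun p N alb = lam" using roots' by blast+
  have E0: "expo_fun p N 0 = 0" "expo_fun p N b = 0"
    using p N by (auto simp: expo_fun_def b_def)
  \<comment> \<open>As \<open>expo_fun\<close> is 0 at 0, a value of at least \<open>lam\<close> at
    some y < al would produce a root in [0, y], against the minimality of \<open>al\<close>. No
    monotonicity of \<open>expo_fun\<close> enters.\<close>
  have below: "y powr (p - 1) * (p - N - (p - 1) * y) < lam" if y: "0 \<le> y" "y < al" for y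
  proof (rule ccontr)
    assume "\<not> ?thesis"
    then have "lam \<le> expo_fun p N y" using y by (simp add: expo_fun_nonneg)
    then obtain \<alpha> where "0 \<le> \<alpha>" "\<alpha> \<le> y" "expo_fun p N \<alpha> = lam"
      using IVT'[of "expo_fun p N" 0 lam y] E0 lam y continuous_on_expo_fun[OF p] by auto
    then show False using roots'[of \<alpha>] al_alb y ord by auto
  qed
  \<comment> \<open>The value at \<open>a\<close> is \<open>C_H\<close>, above \<open>lam\<close>,
    and the value at \<open>b\<close> is 0, so a root lies strictly to the right of
    \<open>a\<close>; \<open>alb\<close> is the larger root and therefore lies there too.\<close>
  have alb: "p * alb > p - N" "alb > 0" if less: "lam < C_H p N"
  proof -
    have Ea: "expo_fun p N a > lam" using less N p by (simp add: a_def expo_fun_max)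
    obtain \<alpha> where \<alpha>: "a \<le> \<alpha>" "\<alpha> \<le> b" "expo_fun p N \<alpha> = lam"
      using IVT2'[of "expo_fun p N" b lam a] E0 lam a Ea continuous_on_expo_fun[OF p] by auto
    have "a < \<alpha>" using \<alpha> Ea by (cases "a = \<alpha>") auto
    moreover have "\<alpha> \<le> alb" using roots'[of \<alpha>] \<alpha> a ord by auto
    ultimately have "a < alb" by simp
    then show "alb > 0" using a by simp
    have "p * a < p * alb" using \<open>a < alb\<close> p by simp
    then show "p * alb > p - N" using a by simp
  qed
  show ?thesis
  proof (intro conjI allI impI; elim conjE)
    fix v :: "'a \<Rightarrow> real"
    assume "\<forall>x. r0 \<le> norm x \<longrightarrow> 0 < v x" "radial_strict_incr r0 v" "strict_supersolution p lam r0 v"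
    then show "\<exists>C>0. \<forall>x. r0 \<le> norm x \<longrightarrow> norm x powr al \<le> C * v x"
      by (intro radial_supersolution_lower_bound[OF r0 p _ _ strict_supersolution_imp_supersolution])
        (use below in \<open>auto simp: N_def\<close>)
  next
    fix w :: "'a \<Rightarrow> real"
    assume pos: "\<forall>x. r0 \<le> norm x \<longrightarrow> 0 < w x" and super: "supersolution p lam r0 w"
      and less: "lam < C_H p (real DIM('a))"
    show "Limsup at_infinity (\<lambda>x. ereal (norm x powr alb / w x)) > 0"
    proof (rule ccontr)
      assume "\<not> ?thesis"
      note dom = Limsup_not_pos_dominated[OF this, of r0]
      show False
        by (rule supersolution_growth_subcritical[OF super _ r0 p2 _ _ _ dom])
          (use pos alb less al_alb in \<open>auto simp: N_def expo_fun_nonneg\<close>)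
    qed
  next
    fix w :: "'a \<Rightarrow> real" and \<tau> :: real
    assume pos: "\<forall>x. r0 \<le> norm x \<longrightarrow> 0 < w x" and super: "supersolution p lam r0 w"
      and eq: "lam = C_H p (real DIM('a))" and \<tau>: "\<tau> > 0"
    \<comment> \<open>In the critical case \<open>lam\<close> is the value of
      \<open>expo_fun\<close> at \<open>a\<close>, so \<open>a\<close> serves as exponent without
      identifying it with \<open>alb\<close>.\<close>
    have lam_eq: "lam = a powr (p - 1) * (p - real DIM('a) - (p - 1) * a)"
      using eq expo_fun_max[OF N(2) p] expo_fun_nonneg[of a p N] a by (simp add: a_def N_def)
    show "Limsup at_infinity (\<lambda>x. ereal (norm x powr ((p - real DIM('a)) / p) * ln (norm x) powr (2 / p)
                           * ln (ln (norm x)) powr \<tau> / w x)) > 0"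
    proof (rule ccontr)
      assume "\<not> ?thesis"
      note dom = Limsup_not_pos_dominated[OF this[folded N_def, folded a_def], of r0]
      show False
        by (rule supersolution_growth_critical[OF super _ r0 p a(1) _ \<tau> lam_eq dom])
          (use pos a in \<open>auto simp: N_def\<close>)
    qed
  qed
qed

end
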